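(* Let $U$ be an open subset of $\mathbb{R}^d$, $\mu$ a Federer measure on $U$ and $F:U\to M_{m,n}(\mathbb{R})$ a continuous map, with $F_j:U\to\mathbb{R}^n$ its $j$-th row. Let $\mathbf r=(r_1,\dots,r_{m+n})$ satisfy $r_i\ge0$ for all $i$ and $r_1+\dots+r_m=r_{m+1}+\dots+r_{m+n}=1$. Assume that for each $j$ the pair $(F_j,\mu)$ is good and non-planar. Then $F_*\mu$ is $\mathbf r$-extremal if and only if $F_*\mu$ is inhomogeneously $\mathbf r$-extremal.
   Context: A Radon measure $\mu$ is $D$-Federer on an open $U$ if $\mu(3V)<D\mu(V)$ for every ball $V\subset U$ centred in $\operatorname{supp}\mu$; $\mu$ is Federer if $\mu$-a.e. point has a neighbourhood on which $\mu$ is $D$-Federer for some $D$. For $f:U\to\mathbb{R}$, $f$ is $(C,\alpha)$-good on $U$ w.r.t. $\mu$ if for every ball $V\subset U$ centred in $\operatorname{supp}\mu$ and every $\varepsilon>0$, $\mu(\{x\in V:|f(x)|<\varepsilon\})\le C(\varepsilon/\sup_{x\in V\cap\operatorname{supp}\mu}|f(x)|)^\alpha\mu(V)$. A pair $(\mathbf f,\mu)$ with $\mathbf f=(f_1,\dots,f_n):U\to\mathbb{R}^n$ is good if for $\mu$-a.e. $x$ there is a neighbourhood $V$ of $x$ and $C,\alpha>0$ such that every real linear combination of $1,f_1,\dots,f_n$ is $(C,\alpha)$-good on $V$; it is non-planar if for every ball $V\subset U$ centred in $\operatorname{supp}\mu$, $\mathbf f(V\cap\operatorname{supp}\mu)$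 is not contained in an affine hyperplane. $F_*\mu$ is the pushforward $\mu(F^{-1}(\cdot))$. For $Y\in M_{m,n}(\mathbb{R})$ with rows $Y_j$ and $\mathbf z\in\mathbb{R}^m$, $(Y;\mathbf z)$ is $\mathbf r$-VWA if there is $\varepsilon>0$ such that for arbitrarily large $Q>1$ there exist $\mathbf q\in\mathbb{Z}^n\setminus\{0\}$, $\mathbf p\in\mathbb{Z}^m$ with $|Y_j\mathbf q+z_j-p_j|<Q^{-(1+\varepsilon)r_j}$ ($1\le j\le m$) and $|q_i|<Q^{r_{m+i}}$ ($1\le i\le n$). A measure $\nu$ on $M_{m,n}(\mathbb{R})$ is $\mathbf r$-extremal if $\nu$-almost every $Y$ is such that $(Y;\mathbf 0)$ is not $\mathbf r$-VWA, and inhomogeneously $\mathbf r$-extremal if for every $\mathbf z\in\mathbb{R}^m$, $\nu$-almost every $Y$ is such that $(Y;\mathbf z)$ is not $\mathbf r$-VWA. *)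

theory Defs
  imports "HOL-Analysis.Analysis"
begin

text \<open>
  A measure on an open set \<open>U\<close> is a measure with \<open>space \<mu> = U\<close> whose measurable sets are the Borel
  subsets of \<open>U\<close>. Balls are open Euclidean balls of positive radius.
\<close>

definition radon_measure_on :: "'a::euclidean_space set \<Rightarrow> 'a measure \<Rightarrow> bool" where
  "radon_measure_on U \<mu> \<longleftrightarrow>
     sets \<mu> = sets (restrict_space borel U) \<and>
     (\<forall>K. compact K \<and> K \<subseteq> U \<longrightarrow> emeasure \<mu> K < \<infinity>) \<and>
     (\<forall>B\<in>sets \<mu>. emeasure \<mu> B = (SUP K\<in>{K. compact K \<and> K \<subseteq> B}. emeasure \<mu> K))"

definition msupp :: "'a::topological_space measure \<Rightarrow> 'a set" where
  "msupp \<mu> = {x \<in> space \<mu>. \<forall>T. open T \<and> x \<in> T \<longrightarrow> emeasure \<mu> (T \<inter> space \<mu>) > 0}"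

text \<open>
  A ball \<open>ball x s \<subseteq> V\<close> may have a tripling that leaves \<open>space \<mu>\<close>; since \<open>\<mu>\<close> lives on \<open>space \<mu>\<close>,
  its measure is that of the part inside.
\<close>
definition federer_const_on :: "real \<Rightarrow> 'a::euclidean_space set \<Rightarrow> 'a measure \<Rightarrow> bool" where
  "federer_const_on D V \<mu> \<longleftrightarrow>
     (\<forall>x\<in>msupp \<mu>. \<forall>s>0. ball x s \<subseteq> V \<longrightarrow>
        emeasure \<mu> (ball x (3 * s) \<inter> space \<mu>) < ennreal D * emeasure \<mu> (ball x s))"

definition federer_on :: "'a::euclidean_space set \<Rightarrow> 'a measure \<Rightarrow> bool" where
  "federer_on U \<mu> \<longleftrightarrow>
     radon_measure_on U \<mu> \<and>
     (AE x in \<mu>. \<exists>V D. open V \<and> x \<in> V \<and> V \<subseteq> U \<and> D > 0 \<and> federer_const_on D V \<mu>)"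

text \<open>Real powers on \<open>[0, \<infinity>]\<close>, meant for exponents \<open>a > 0\<close>.\<close>
definition ennreal_powr :: "ennreal \<Rightarrow> real \<Rightarrow> ennreal" where
  "ennreal_powr t a = (if t = \<infinity> then \<infinity> else ennreal (enn2real t powr a))"

text \<open>
  The supremum is taken in \<open>[0, \<infinity>]\<close>. If it is \<open>0\<close>, then \<open>\<epsilon> / 0 = \<infinity>\<close> and the inequality holds
  trivially; if it is \<open>\<infinity>\<close>, the quotient is \<open>0\<close>. The function is intended to be Borel on \<open>V\<close>, so
  that its sublevel sets are measurable.
\<close>
definition good_fun_on ::
    "real \<Rightarrow> real \<Rightarrow> 'a::euclidean_space set \<Rightarrow> 'a measure \<Rightarrow> ('a \<Rightarrow> real) \<Rightarrow> bool" where
  "good_fun_on C \<alpha> V \<mu> f \<longleftrightarrow>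
     (\<forall>x\<in>msupp \<mu>. \<forall>s>0. ball x s \<subseteq> V \<longrightarrow>
        (\<forall>\<epsilon>>0. emeasure \<mu> {y \<in> ball x s. \<bar>f y\<bar> < \<epsilon>}
           \<le> ennreal C *
               ennreal_powr (ennreal \<epsilon> / (SUP y\<in>ball x s \<inter> msupp \<mu>. ennreal \<bar>f y\<bar>)) \<alpha> *
               emeasure \<mu> (ball x s)))"

definition good_pair_on ::
    "'a::euclidean_space set \<Rightarrow> ('a \<Rightarrow> real ^ 'n) \<Rightarrow> 'a measure \<Rightarrow> bool" where
  "good_pair_on U f \<mu> \<longleftrightarrow>
     (AE x in \<mu>. \<exists>V C \<alpha>. open V \<and> x \<in> V \<and> V \<subseteq> U \<and> C > 0 \<and> \<alpha> > 0 \<and>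
        (\<forall>(c0::real) (c::real ^ 'n).
           good_fun_on C \<alpha> V \<mu> (\<lambda>y. c0 + (\<Sum>i\<in>UNIV. c $ i * f y $ i))))"

definition nonplanar_on ::
    "'a::euclidean_space set \<Rightarrow> ('a \<Rightarrow> real ^ 'n) \<Rightarrow> 'a measure \<Rightarrow> bool" where
  "nonplanar_on U f \<mu> \<longleftrightarrow>
     (\<forall>x\<in>msupp \<mu>. \<forall>s>0. ball x s \<subseteq> U \<longrightarrow>
        \<not> (\<exists>a b. a \<noteq> 0 \<and> f ` (ball x s \<inter> msupp \<mu>) \<subseteq> {v. a \<bullet> v = b}))"

text \<open>
  Matrices with \<open>m\<close> rows and \<open>n\<close> columns have type \<open>real ^ 'n ^ 'm\<close>, and the weight vector
  \<open>(r\<^sub>1, \<dots>, r\<^sub>m\<^sub>+\<^sub>n)\<close> is indexed by \<open>'m + 'n\<close>: \<open>Inl j\<close> stands for the index \<open>j\<close> and \<open>Inr i\<close> for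
  \<open>m + i\<close>.
\<close>
definition VWA :: "real ^ ('m + 'n) \<Rightarrow> real ^ 'n ^ 'm \<Rightarrow> real ^ 'm \<Rightarrow> bool" where
  "VWA r Y z \<longleftrightarrow>
     (\<exists>\<epsilon>>0. \<forall>Q0::real. \<exists>Q>Q0. Q > 1 \<and>
        (\<exists>(q::int ^ 'n) (p::int ^ 'm). q \<noteq> 0 \<and>
           (\<forall>j. \<bar>(\<Sum>i\<in>UNIV. Y $ j $ i * real_of_int (q $ i)) + z $ j - real_of_int (p $ j)\<bar>
                  < Q powr (- (1 + \<epsilon>) * r $ Inl j)) \<and>
           (\<forall>i. \<bar>real_of_int (q $ i)\<bar> < Q powr (r $ Inr i))))"

definition extremal :: "real ^ ('m + 'n) \<Rightarrow> (real ^ 'n ^ 'm) measure \<Rightarrow> bool" where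
  "extremal r \<nu> \<longleftrightarrow> (AE Y in \<nu>. \<not> VWA r Y 0)"

definition inhomogeneously_extremal ::
    "real ^ ('m + 'n) \<Rightarrow> (real ^ 'n ^ 'm) measure \<Rightarrow> bool" where
  "inhomogeneously_extremal r \<nu> \<longleftrightarrow> (\<forall>z. AE Y in \<nu>. \<not> VWA r Y z)"

end

theory Submission
  imports Defs
begin

text \<open>
  Fix \<open>z\<close> and restrict to dyadic heights \<open>Q = 2\<^sup>k\<close>. For an integer pair \<open>a = (q, p)\<close> let
  \<open>L e k a\<close> be the set of points \<open>x\<close> at which \<open>F x q + z - p\<close> is small with exponent \<open>1 + e\<close>.
  Subtracting two different solutions of the same height gives a homogeneous solution, so by
  extremality almost every point lies in at most one of the sets \<open>L (e/2) k a\<close> for each large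
  \<open>k\<close>; let \<open>N\<^sub>K\<close> be the exceptional set for some \<open>k \<ge> K\<close>. Around a point of \<open>L e k a\<close> in the
  support, take a ball that stays in \<open>L (e/2) k a\<close> on the support while a bounded multiple of it
  does not; non-planarity guarantees that it is small, and goodness that \<open>L e k a\<close> occupies an
  exponentially small proportion of it. Balls of which \<open>N\<^sub>K\<close> occupies at least half cover a set of
  measure \<open>O(\<mu> N\<^sub>K)\<close>, which tends to \<open>0\<close>. The other balls for different \<open>a\<close> are essentially
  disjoint off \<open>N\<^sub>K\<close>, so that the measures of the remaining parts of \<open>\<Union>\<^sub>a L e k a\<close> are summable
  over \<open>k\<close> and the Borel--Cantelli lemma applies.
\<close>

subsection \<open>Federer measures and the transference principle\<close>

lemma AE_Union_open:
  fixes M :: "'a::second_countable_topology measure"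
  assumes "\<And>W. W \<in> \<W> \<Longrightarrow> open W"
    and "\<And>W. W \<in> \<W> \<Longrightarrow> AE x in M. x \<in> W \<longrightarrow> P x"
  shows "AE x in M. x \<in> \<Union>\<W> \<longrightarrow> P x"
proof -
  obtain \<V> where \<V>: "\<V> \<subseteq> \<W>" "countable \<V>" "\<Union>\<V> = \<Union>\<W>"
    using Lindelof[OF assms(1)] by metis
  have "AE x in M. \<forall>W\<in>\<V>. x \<in> W \<longrightarrow> P x"
    by (rule AE_ball_countable') (use \<V> assms(2) in auto)
  then show ?thesis
    unfolding \<V>(3)[symmetric] by eventually_elim auto
qed

text \<open>The complement of the support is a union of possibly uncountably many open null sets; by
  Lindelof a countable subfamily has the same union.\<close>

lemma AE_msupp:
  fixes M :: "'a::second_countable_topology measure"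
  assumes "\<And>T. open T \<Longrightarrow> T \<inter> space M \<in> sets M"
  shows "AE x in M. x \<in> msupp M"
proof -
  define \<T> where "\<T> = {T. open T \<and> emeasure M (T \<inter> space M) = 0}"
  have "AE x in M. x \<in> \<Union>\<T> \<longrightarrow> False"
  proof (rule AE_Union_open)
    fix T assume "T \<in> \<T>"
    then have "T \<inter> space M \<in> null_sets M"
      using assms by (auto simp: \<T>_def)
    then have "AE x in M. x \<notin> T \<inter> space M"
      by (rule AE_not_in)
    then show "AE x in M. x \<in> T \<longrightarrow> False"
      using AE_space by eventually_elim auto
  qed (auto simp: \<T>_def)
  then show ?thesis
    using AE_space by eventually_elim (auto simp: msupp_def \<T>_def zero_less_iff_neq_zero)
qed

lemma msupp_sets:
  fixes M :: "'a::topological_space measure"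
  assumes "\<And>T. open T \<Longrightarrow> T \<inter> space M \<in> sets M"
  shows "msupp M \<in> sets M"
proof -
  have "msupp M = space M - \<Union>{T. open T \<and> emeasure M (T \<inter> space M) = 0} \<inter> space M"
    by (auto simp: msupp_def zero_less_iff_neq_zero)
  also have "\<dots> \<in> sets M"
    by (intro sets.Diff sets.top assms) auto
  finally show ?thesis .
qed

text \<open>Subadditivity on the \<open>X i\<close> meets additivity on the disjoint
  \<open>Z i\<close>. Local estimates are summed this way twice: over the balls of a Vitali family,
  and over all indices \<open>a\<close> of one level \<open>k\<close>.\<close>

lemma emeasure_le_disjoint_cover:
  assumes C: "countable C" and X: "\<And>i. i \<in> C \<Longrightarrow> X i \<in> sets M" and Z: "\<And>i. i \<in> C \<Longrightarrow> Z i \<in> sets M"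
    and G: "G \<subseteq> (\<Union>i\<in>C. X i)" and N: "N \<in> sets M" "\<And>i. i \<in> C \<Longrightarrow> Z i \<subseteq> N"
    and disj: "disjoint_family_on Z C"
    and le: "\<And>i. i \<in> C \<Longrightarrow> emeasure M (X i) \<le> c * emeasure M (Z i)"
  shows "emeasure M G \<le> c * emeasure M N"
proof -
  \<comment> \<open>The series lemmas want natural indices: \<open>C\<close> is enumerated and both
    families are padded with the empty set, so that finite \<open>C\<close> needs no separate
    case.\<close>
  define R where "R = to_nat_on C ` C"
  define X' where "X' = (\<lambda>n. if n \<in> R then X (from_nat_into C n) else {})"
  define Z' where "Z' = (\<lambda>n. if n \<in> R then Z (from_nat_into C n) else {})"
  have R: "from_nat_into C n \<in> C" if "n \<in> R" for n
    using that C by (auto simp: R_def)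
  have sets: "range X' \<subseteq> sets M" "range Z' \<subseteq> sets M"
    using X Z R by (auto simp: X'_def Z'_def)
  have "disjoint_family Z'"
    unfolding disjoint_family_on_def
  proof (intro ballI impI)
    fix a b :: nat assume "a \<noteq> b"
    show "Z' a \<inter> Z' b = {}"
    proof (cases "a \<in> R \<and> b \<in> R")
      case True
      then have "from_nat_into C a \<noteq> from_nat_into C b"
        using C \<open>a \<noteq> b\<close> by (auto simp: R_def)
      then show ?thesis
        using True R disj unfolding Z'_def disjoint_family_on_def by auto
    qed (auto simp: Z'_def)
  qed
  have "G \<subseteq> (\<Union>n. X' n)"
  proof
    fix x assume "x \<in> G"
    then obtain i where "i \<in> C" "x \<in> X i" using G by auto
    then have "x \<in> X' (to_nat_on C i)"
      using C by (auto simp: X'_def R_def)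
    then show "x \<in> (\<Union>n. X' n)" by blast
  qed
  then have "emeasure M G \<le> emeasure M (\<Union>n. X' n)"
    using sets by (intro emeasure_mono) auto
  also have "\<dots> \<le> (\<Sum>n. emeasure M (X' n))"
    by (rule emeasure_subadditive_countably) fact
  also have "\<dots> \<le> (\<Sum>n. c * emeasure M (Z' n))"
    using le R by (intro suminf_le) (auto simp: X'_def Z'_def)
  also have "\<dots> = c * emeasure M (\<Union>n. Z' n)"
    using suminf_emeasure[OF sets(2) \<open>disjoint_family Z'\<close>] by simp
  also have "\<dots> \<le> c * emeasure M N"
    using N R by (intro mult_left_mono emeasure_mono) (auto simp: Z'_def split: if_splits)
  finally show ?thesis .
qed

section \<open>Vitali coverings for Federer measures and the transference estimate\<close>

lemma federer_const_on_nine: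
  assumes "federer_const_on D V M" "x \<in> msupp M" "s > 0" "ball x (9 * s) \<subseteq> V" "V \<subseteq> space M"
  shows "emeasure M (ball x (9 * s)) \<le> ennreal D * ennreal D * emeasure M (ball x s)"
proof -
  have *: "emeasure M (ball x (3 * t)) \<le> ennreal D * emeasure M (ball x t)"
    if "t > 0" "ball x (3 * t) \<subseteq> V" for t
  proof -
    have "ball x t \<subseteq> V" using that by (auto simp: subset_iff)
    moreover have "ball x (3 * t) \<inter> space M = ball x (3 * t)"
      using that assms(5) by blast
    ultimately show ?thesis
      using assms(1,2) that unfolding federer_const_on_def by (metis less_imp_le)
  qed
  have "ball x (3 * s) \<subseteq> V" using assms(3,4) by (auto simp: subset_iff)
  then have "emeasure M (ball x (3 * s)) \<le> ennreal D * emeasure M (ball x s)"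
    using * assms by simp
  moreover have "emeasure M (ball x (9 * s)) \<le> ennreal D * emeasure M (ball x (3 * s))"
    using *[of "3 * s"] assms by simp
  ultimately show ?thesis
    by (metis (no_types, opaque_lifting) dual_order.trans mult.assoc mult_left_mono zero_le)
qed

text \<open>Vitali's lemma leaves disjoint balls whose fivefold enlargements cover \<open>G\<close>.
  In each ninefold enlargement \<open>G\<close> has proportion at most \<open>\<kappa>\<close>, two
  triplings lead back to the ball, and at least half of the ball lies in \<open>N\<close>; the
  traces on \<open>N\<close> are disjoint.\<close>

lemma vitali_federer_estimate:
  fixes M :: "'a::euclidean_space measure"
  assumes F: "federer_const_on D V M" and V: "V \<subseteq> space M"
    and balls: "\<And>x s. ball x s \<subseteq> V \<Longrightarrow> ball x s \<in> sets M"
    and T: "\<And>x s. (x, s) \<in> T \<Longrightarrow> x \<in> msupp M \<and> 0 < s \<and> s \<le> R \<and> ball x (9 * s) \<subseteq> V"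
    and G: "G \<in> sets M" "G \<subseteq> (\<Union>(x, s)\<in>T. ball x s)"
    and N: "N \<in> sets M"
    and \<kappa>: "\<And>x s. (x, s) \<in> T \<Longrightarrow> emeasure M (G \<inter> ball x (9 * s)) \<le> \<kappa> * emeasure M (ball x (9 * s))"
    and half: "\<And>x s. (x, s) \<in> T \<Longrightarrow> emeasure M (ball x s) \<le> 2 * emeasure M (ball x s \<inter> N)"
  shows "emeasure M G \<le> 2 * \<kappa> * (ennreal D * ennreal D) * emeasure M N"
proof -
  have "G \<subseteq> (\<Union>i\<in>T. ball (fst i) (snd i))" using G(2) by (simp add: case_prod_unfold)
  moreover have "0 < snd i \<and> snd i \<le> R" if "i \<in> T" for i
    using T[of "fst i" "snd i"] that by simp
  ultimately obtain C where C: "countable C" "C \<subseteq> T"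
    "pairwise (\<lambda>i j. disjnt (ball (fst i) (snd i)) (ball (fst j) (snd j))) C"
    "G \<subseteq> (\<Union>i\<in>C. ball (fst i) (5 * snd i))"
    by (rule Vitali_covering_lemma_balls[of G fst snd T R])
  have T': "fst i \<in> msupp M" "0 < snd i" "ball (fst i) (9 * snd i) \<subseteq> V" "ball (fst i) (snd i) \<subseteq> V"
    if "i \<in> C" for i
  proof -
    have "(fst i, snd i) \<in> T" using C(2) that by auto
    from T[OF this] show "fst i \<in> msupp M" "0 < snd i" and 9: "ball (fst i) (9 * snd i) \<subseteq> V"
      by auto
    with 9 show "ball (fst i) (snd i) \<subseteq> V" by (auto simp: subset_iff)
  qed
  show ?thesis
  proof (rule emeasure_le_disjoint_cover[OF C(1)])
    show "G \<inter> ball (fst i) (9 * snd i) \<in> sets M" if "i \<in> C" for i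
      using G(1) balls T'(3)[OF that] by auto
    show "ball (fst i) (snd i) \<inter> N \<in> sets M" if "i \<in> C" for i
      using N balls T'(4)[OF that] by auto
    show "G \<subseteq> (\<Union>i\<in>C. G \<inter> ball (fst i) (9 * snd i))"
    proof
      fix x assume "x \<in> G"
      then obtain i where "i \<in> C" "x \<in> ball (fst i) (5 * snd i)" using C(4) by auto
      moreover have "ball (fst i) (5 * snd i) \<subseteq> ball (fst i) (9 * snd i)"
        using T'(2)[OF \<open>i \<in> C\<close>] by (intro subset_ball) auto
      ultimately show "x \<in> (\<Union>i\<in>C. G \<inter> ball (fst i) (9 * snd i))"
        using \<open>x \<in> G\<close> by blast
    qed
    show "disjoint_family_on (\<lambda>i. ball (fst i) (snd i) \<inter> N) C"
      using C(3) unfolding disjoint_family_on_def pairwise_def disjnt_def by blast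
    fix i assume i: "i \<in> C"
    then have iT: "(fst i, snd i) \<in> T" using C(2) by auto
    have "emeasure M (G \<inter> ball (fst i) (9 * snd i)) \<le> \<kappa> * emeasure M (ball (fst i) (9 * snd i))"
      by (rule \<kappa>[OF iT])
    also have "\<dots> \<le> \<kappa> * (ennreal D * ennreal D * emeasure M (ball (fst i) (snd i)))"
      using federer_const_on_nine[OF F T'(1,2,3)[OF i] V] by (intro mult_left_mono) auto
    also have "\<dots> \<le> \<kappa> * (ennreal D * ennreal D * (2 * emeasure M (ball (fst i) (snd i) \<inter> N)))"
      using half[OF iT] by (intro mult_left_mono) auto
    also have "\<dots> = 2 * \<kappa> * (ennreal D * ennreal D) * emeasure M (ball (fst i) (snd i) \<inter> N)"
      by (simp add: mult_ac)
    finally show "emeasure M (G \<inter> ball (fst i) (9 * snd i)) \<le>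
      2 * \<kappa> * (ennreal D * ennreal D) * emeasure M (ball (fst i) (snd i) \<inter> N)" .
  qed (use N in auto)
qed

lemma emeasure_le_twice_Diff:
  assumes "B \<in> sets M" "N \<in> sets M" "emeasure M B < \<infinity>"
    and "\<not> emeasure M B \<le> 2 * emeasure M (B \<inter> N)"
  shows "emeasure M B \<le> 2 * emeasure M (B - N)"
proof -
  have B: "emeasure M B = emeasure M (B \<inter> N) + emeasure M (B - N)"
    using assms(1,2) by (subst plus_emeasure) (auto simp: Un_Diff_Int intro!: arg_cong[where f="emeasure M"])
  have "emeasure M (B \<inter> N) < \<infinity>" "emeasure M (B - N) < \<infinity>"
    using assms(3) unfolding B by auto
  then obtain a b where ab: "emeasure M (B \<inter> N) = ennreal a" "emeasure M (B - N) = ennreal b" "0 \<le> a" "0 \<le> b"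
    by (metis ennreal_cases infinity_ennreal_def less_irrefl)
  have 2: "(2::ennreal) = ennreal 2" by simp
  have "\<not> a + b \<le> 2 * a"
    using assms(4) ab unfolding B ab 2
    by (simp del: ennreal_numeral flip: ennreal_plus ennreal_mult)
  then have "ennreal (a + b) \<le> ennreal (2 * b)"
    by (intro ennreal_leI) simp
  then show ?thesis
    using ab unfolding B ab 2
    by (simp del: ennreal_numeral flip: ennreal_plus ennreal_mult)
qed

text \<open>
  \<open>I k a\<close> are the approximation sets of interest and \<open>J k a\<close> slightly larger ones. The contraction
  hypothesis asks for ratio \<open>9\<close> because tripling twice absorbs the factor \<open>5\<close> of Vitali's lemma.
\<close>
proposition inhomogeneous_transference:
  fixes M :: "'a::euclidean_space measure"
    and I J :: "nat \<Rightarrow> 'i::countable \<Rightarrow> 'a set"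
  assumes opens: "\<And>T. open T \<Longrightarrow> T \<inter> space M \<in> sets M"
    and F: "federer_const_on D V M"
    and V: "V \<subseteq> space M" "V \<in> sets M" "emeasure M V < \<infinity>"
    and W: "W \<in> sets M"
    and I: "\<And>k a. I k a \<in> sets M" and J: "\<And>k a. J k a \<in> sets M"
    and \<kappa>: "\<And>k. \<kappa> k \<ge> 0" "summable \<kappa>"
    and contracting: "\<And>k a x. k \<ge> k\<^sub>0 \<Longrightarrow> a \<in> A k \<Longrightarrow> x \<in> I k a \<inter> msupp M \<inter> W \<Longrightarrow>
       \<exists>s>0. s \<le> R \<and> ball x (9 * s) \<subseteq> V \<and> ball x s \<inter> msupp M \<subseteq> J k a \<and>
         emeasure M (I k a \<inter> ball x (9 * s)) \<le> ennreal (\<kappa> k) * emeasure M (ball x (9 * s))"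
    and intersection: "AE x in M. x \<in> V \<longrightarrow>
       \<not> (\<exists>\<^sub>\<infinity>k. \<exists>a\<in>A k. \<exists>b\<in>A k. a \<noteq> b \<and> x \<in> J k a \<inter> J k b)"
  shows "AE x in M. x \<in> W \<longrightarrow> \<not> (\<exists>\<^sub>\<infinity>k. \<exists>a\<in>A k. x \<in> I k a)"
proof -
  have supp: "AE x in M. x \<in> msupp M" "msupp M \<in> sets M"
    using AE_msupp msupp_sets opens by blast+
  have balls: "ball x s \<in> sets M" if "ball x s \<subseteq> V" for x s
    using opens[of "ball x s"] that V(1) by (simp add: Int_absorb2)
  define E where "E k = V \<inter> (\<Union>a\<in>A k. \<Union>b\<in>A k - {a}. J k a \<inter> J k b)" for k
  define N where "N K = (\<Union>k\<in>{K..}. E k)" for K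
  have E: "E k \<in> sets M" for k
    unfolding E_def using V J by (intro sets.Int sets.countable_UN' countableI_type) auto
  have N: "N K \<in> sets M" for K
    unfolding N_def using E by (intro sets.countable_UN' countableI_type) auto
  have NV: "N K \<subseteq> V" for K
    by (auto simp: N_def E_def)
  \<comment> \<open>The \<open>N K\<close> decrease to the set of points of \<open>V\<close> lying
    in two different sets \<open>J k a\<close>, \<open>J k b\<close> for infinitely many
    \<open>k\<close>, which is null by \<open>intersection\<close>; continuity from above applies
    because \<open>V\<close> has finite measure.\<close>
  have N0: "(\<lambda>K. emeasure M (N K)) \<longlonglongrightarrow> 0"
  proof -
    have "(\<lambda>K. emeasure M (N K)) \<longlonglongrightarrow> emeasure M (\<Inter>K. N K)"
    proof (rule Lim_emeasure_decseq)
      show "decseq N" unfolding decseq_def N_def by (intro allI impI UN_mono) auto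
      show "emeasure M (N K) \<noteq> \<infinity>" for K
        using emeasure_mono[OF NV V(2), of K] V(3) by auto
    qed (use N in auto)
    also have "emeasure M (\<Inter>K. N K) = 0"
    proof -
      have *: "x \<in> V \<and> (\<exists>\<^sub>\<infinity>k. \<exists>a\<in>A k. \<exists>b\<in>A k. a \<noteq> b \<and> x \<in> J k a \<inter> J k b)"
        if "\<forall>K. x \<in> N K" for x
        using that unfolding INFM_nat_le N_def E_def by fastforce
      have "AE x in M. x \<notin> (\<Inter>K. N K)"
        using intersection by eventually_elim (use * in blast)
      moreover have "(\<Inter>K. N K) \<in> sets M" using N by auto
      ultimately have "(\<Inter>K. N K) \<in> null_sets M" using AE_iff_null_sets by blast
      then show ?thesis by (rule null_setsD1)
    qed
    finally show ?thesis .
  qed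
  \<comment> \<open>These balls are at least half filled by \<open>N K\<close>. Their union
    \<open>H K\<close> is open, hence measurable, and the Vitali estimate with the trivial
    proportion 1 bounds its measure by a multiple of that of \<open>N K\<close>.\<close>
  define T where "T K = {(x, s). x \<in> msupp M \<and> 0 < s \<and> s \<le> R \<and> ball x (9 * s) \<subseteq> V \<and>
      emeasure M (ball x s) \<le> 2 * emeasure M (ball x s \<inter> N K)}" for K
  define H where "H K = (\<Union>(x, s)\<in>T K. ball x s)" for K
  have H: "H K \<in> sets M" for K
  proof -
    have "ball x s \<subseteq> V" if "(x, s) \<in> T K" for x s
    proof -
      have "ball x s \<subseteq> ball x (9 * s)" using that by (intro subset_ball) (auto simp: T_def)
      then show ?thesis using that by (auto simp: T_def)
    qed
    then have "H K \<subseteq> space M" using V(1) by (force simp: H_def)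
    moreover have "open (H K)" by (auto simp: H_def)
    ultimately show ?thesis using opens[of "H K"] by (simp add: Int_absorb2)
  qed
  have H_le: "emeasure M (H K) \<le> 2 * 1 * (ennreal D * ennreal D) * emeasure M (N K)" for K
  proof (rule vitali_federer_estimate[OF F V(1) balls _ H _ N])
    show "emeasure M (H K \<inter> ball x (9 * s)) \<le> 1 * emeasure M (ball x (9 * s))"
      if "(x, s) \<in> T K" for x s
      using that balls by (auto simp: T_def intro!: emeasure_mono)
  qed (auto simp: T_def H_def)
  have H_null: "AE x in M. \<exists>K. x \<notin> H K"
  proof (rule AE_I)
    show "{x \<in> space M. \<not> (\<exists>K. x \<notin> H K)} \<subseteq> (\<Inter>K. H K)" by auto
    show "(\<Inter>K. H K) \<in> sets M" using H by auto
    have "(\<lambda>K. 2 * 1 * (ennreal D * ennreal D) * emeasure M (N K)) \<longlonglongrightarrow> 2 * 1 * (ennreal D * ennreal D) * 0"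
      by (intro ennreal_tendsto_cmult N0) (auto simp: ennreal_mult_less_top)
    then have "emeasure M (\<Inter>K. H K) \<le> 2 * 1 * (ennreal D * ennreal D) * 0"
    proof (rule LIMSEQ_le_const, intro exI allI impI)
      fix K
      have "emeasure M (\<Inter>K. H K) \<le> emeasure M (H K)"
        using H by (intro emeasure_mono) auto
      then show "emeasure M (\<Inter>K. H K) \<le> 2 * 1 * (ennreal D * ennreal D) * emeasure M (N K)"
        using H_le order_trans by blast
    qed
    then show "emeasure M (\<Inter>K. H K) = 0" by simp
  qed
  \<comment> \<open>Points of \<open>H K\<close> are removed so that a contracting ball centred at a
    remaining point is not in \<open>T K\<close>: more than half of it avoids
    \<open>N K\<close>.\<close>
  define G where "G K k a = I k a \<inter> msupp M \<inter> W - H K" for K k a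
  have G: "G K k a \<in> sets M" for K k a
    unfolding G_def using I H W supp by auto
  have G_le: "emeasure M (G K k a) \<le>
      2 * ennreal (\<kappa> k) * (ennreal D * ennreal D) * emeasure M (J k a \<inter> V - N K)"
    if "k \<ge> k\<^sub>0" "a \<in> A k" for K k a
  proof -
    define P where "P x s \<longleftrightarrow> s > 0 \<and> s \<le> R \<and> ball x (9 * s) \<subseteq> V \<and> ball x s \<inter> msupp M \<subseteq> J k a \<and>
         emeasure M (I k a \<inter> ball x (9 * s)) \<le> ennreal (\<kappa> k) * emeasure M (ball x (9 * s))" for x s
    have P: "\<exists>s. P x s" if "x \<in> G K k a" for x
      using contracting[OF \<open>k \<ge> k\<^sub>0\<close> \<open>a \<in> A k\<close>, of x] that by (auto simp: G_def P_def)
    show ?thesis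
    proof (rule vitali_federer_estimate[OF F V(1) balls, where T="{(x, s). x \<in> G K k a \<and> P x s}" and R=R])
      show "G K k a \<subseteq> (\<Union>(x, s)\<in>{(x, s). x \<in> G K k a \<and> P x s}. ball x s)"
      proof
        fix x assume x: "x \<in> G K k a"
        then obtain s where "P x s" using P by auto
        moreover from this have "x \<in> ball x s" by (simp add: P_def)
        ultimately show "x \<in> (\<Union>(x, s)\<in>{(x, s). x \<in> G K k a \<and> P x s}. ball x s)"
          using x by blast
      qed
      show "J k a \<inter> V - N K \<in> sets M" using J V N by auto
      fix x s assume "(x, s) \<in> {(x, s). x \<in> G K k a \<and> P x s}"
      then have x: "x \<in> G K k a" and s: "P x s" by auto
      show "x \<in> msupp M \<and> 0 < s \<and> s \<le> R \<and> ball x (9 * s) \<subseteq> V"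
        using x s by (auto simp: G_def P_def)
      have B9: "ball x (9 * s) \<in> sets M" using s balls by (auto simp: P_def)
      have "emeasure M (G K k a \<inter> ball x (9 * s)) \<le> emeasure M (I k a \<inter> ball x (9 * s))"
        using I B9 by (intro emeasure_mono) (auto simp: G_def)
      then show "emeasure M (G K k a \<inter> ball x (9 * s)) \<le> ennreal (\<kappa> k) * emeasure M (ball x (9 * s))"
        using s by (auto simp: P_def)
      have BV: "ball x s \<subseteq> V"
      proof -
        have "ball x s \<subseteq> ball x (9 * s)" using s by (intro subset_ball) (auto simp: P_def)
        then show ?thesis using s by (auto simp: P_def)
      qed
      have "x \<in> ball x s" using s by (auto simp: P_def)
      with x have "(x, s) \<notin> T K" by (auto simp: G_def H_def)
      then have "\<not> emeasure M (ball x s) \<le> 2 * emeasure M (ball x s \<inter> N K)"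
        using x s by (auto simp: T_def G_def P_def)
      moreover have "emeasure M (ball x s) < \<infinity>"
        using emeasure_mono[OF BV V(2)] V(3) by (metis order_le_less_trans)
      ultimately have "emeasure M (ball x s) \<le> 2 * emeasure M (ball x s - N K)"
        using balls[OF BV] N by (intro emeasure_le_twice_Diff) auto
      \<comment> \<open>Contraction puts only the support part of the ball into
        \<open>J k a\<close>, so the comparison holds up to a null set.\<close>
      also have "emeasure M (ball x s - N K) \<le> emeasure M (ball x s \<inter> (J k a \<inter> V - N K))"
      proof (rule emeasure_mono_AE)
        show "AE y in M. y \<in> ball x s - N K \<longrightarrow> y \<in> ball x s \<inter> (J k a \<inter> V - N K)"
          using supp(1) by eventually_elim (use s BV in \<open>auto simp: P_def\<close>)
      qed (use balls[OF BV] J V N in auto)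
      finally show "emeasure M (ball x s) \<le> 2 * emeasure M (ball x s \<inter> (J k a \<inter> V - N K))"
        by (simp add: mult_left_mono)
    qed (use G in auto)
  qed
  define GG where "GG K k = (\<Union>a\<in>A k. G K k a)" for K k
  have GG: "GG K k \<in> sets M" for K k
    unfolding GG_def using G by (intro sets.countable_UN' countableI_type) auto
  \<comment> \<open>For \<open>k \<ge> K\<close> two of the sets \<open>J k a\<close> meet inside
    \<open>V\<close> only in \<open>N K\<close>. The bounds therefore add up to a multiple of the
    measure of \<open>V\<close>, however many \<open>a\<close> there are.\<close>
  have GG_le: "emeasure M (GG K k) \<le> 2 * ennreal (\<kappa> k) * (ennreal D * ennreal D) * emeasure M V"
    if "k \<ge> k\<^sub>0" "k \<ge> K" for K k
  proof (rule emeasure_le_disjoint_cover[where C="A k" and X="G K k"])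
    show "disjoint_family_on (\<lambda>a. J k a \<inter> V - N K) (A k)"
    proof (unfold disjoint_family_on_def, intro ballI impI)
      fix a b assume "a \<in> A k" "b \<in> A k" "a \<noteq> b"
      then have "J k a \<inter> J k b \<inter> V \<subseteq> E k" unfolding E_def by blast
      also have "E k \<subseteq> N K" using that by (auto simp: N_def)
      finally show "(J k a \<inter> V - N K) \<inter> (J k b \<inter> V - N K) = {}" by blast
    qed
  qed (use G J V N G_le that in \<open>auto simp: GG_def\<close>)
  have BC: "AE x in M. \<forall>\<^sub>F k in sequentially. x \<notin> GG K k" for K
  proof -
    define v where "v = measure M V"
    have v: "emeasure M V = ennreal v" "v \<ge> 0"
      using V(3) by (auto simp: v_def emeasure_eq_ennreal_measure)
    define k1 where "k1 = max K k\<^sub>0"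
    \<comment> \<open>\<open>D\<close> may be negative here, in which case
      \<open>ennreal D = 0\<close>; the real constant of the summable bound has to agree with
      that.\<close>
    define D' where "D' = max 0 D"
    have D': "ennreal D = ennreal D'" "D' \<ge> 0" by (auto simp: D'_def ennreal_eq_0_iff max_def ennreal_neg)
    define c where "c = (2 * (D' * D') * v)"
    have c: "c \<ge> 0" using v D' by (auto simp: c_def)
    have le: "emeasure M (GG K (k + k1)) \<le> ennreal (c * \<kappa> (k + k1))" for k
    proof -
      have "ennreal (c * \<kappa> (k + k1)) = 2 * ennreal (\<kappa> (k + k1)) * (ennreal D * ennreal D) * emeasure M V"
        using v D' \<kappa>(1)[of "k + k1"] unfolding c_def D' v
        by (simp add: ennreal_mult mult_ac)
      then show ?thesis using GG_le[of "k + k1" K] by (simp add: k1_def)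
    qed
    have "AE x in M. \<forall>\<^sub>F k in sequentially. x \<in> space M - GG K (k + k1)"
    proof (rule borel_cantelli_AE1)
      show "emeasure M (GG K (k + k1)) < \<infinity>" for k
        using le[of k] by (simp add: le_less_trans)
      show "summable (\<lambda>k. measure M (GG K (k + k1)))"
      proof (rule summable_comparison_test')
        show "summable (\<lambda>k. c * \<kappa> (k + k1))"
          using \<kappa>(2) by (intro summable_mult) (simp add: summable_iff_shift)
        show "norm (measure M (GG K (k + k1))) \<le> c * \<kappa> (k + k1)" for k
          using enn2real_mono[OF le[of k]] c \<kappa>(1) by (simp add: measure_def)
      qed
    qed (use GG in auto)
    then show ?thesis
    proof eventually_elim
      case (elim x)
      then have "\<forall>\<^sub>F k in sequentially. x \<notin> GG K (k + k1)"
        by eventually_elim auto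
      then show ?case using eventually_sequentially_seg[of "\<lambda>k. x \<notin> GG K k" k1] by simp
    qed
  qed
  \<comment> \<open>The \<open>K\<close> with \<open>x \<notin> H K\<close> depends on
    \<open>x\<close>, so the null sets of all \<open>K\<close> are discarded together.\<close>
  have "AE x in M. \<forall>K. \<forall>\<^sub>F k in sequentially. x \<notin> GG K k"
    using BC by (simp add: AE_all_countable)
  with H_null supp(1) show ?thesis
  proof eventually_elim
    case (elim x)
    show ?case
    proof
      assume "x \<in> W"
      obtain K where "x \<notin> H K" using elim by auto
      have "\<forall>\<^sub>F k in sequentially. x \<notin> GG K k" using elim by auto
      then have "\<forall>\<^sub>F k in sequentially. \<not> (\<exists>a\<in>A k. x \<in> I k a)"
        by eventually_elim (use \<open>x \<in> W\<close> \<open>x \<notin> H K\<close> elim in \<open>auto simp: GG_def G_def\<close>)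
      then show "\<not> (\<exists>\<^sub>\<infinity>k. \<exists>a\<in>A k. x \<in> I k a)"
        by (simp add: frequently_def cofinite_eq_sequentially)
    qed
  qed
qed

subsection \<open>Dyadic form of approximability\<close>

definition affine_form :: "real ^ 'n ^ 'm \<Rightarrow> real ^ 'm \<Rightarrow> (int ^ 'n) \<times> (int ^ 'm) \<Rightarrow> 'm \<Rightarrow> real" where
  "affine_form Y z a j =
     (\<Sum>i\<in>UNIV. Y $ j $ i * real_of_int (fst a $ i)) + z $ j - real_of_int (snd a $ j)"

definition dyadic_approx ::
    "real ^ ('m + 'n) \<Rightarrow> real \<Rightarrow> nat \<Rightarrow> real ^ 'n ^ 'm \<Rightarrow> real ^ 'm \<Rightarrow> (int ^ 'n) \<times> (int ^ 'm) \<Rightarrow> bool" where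
  "dyadic_approx r e k Y z a \<longleftrightarrow>
     (\<forall>j. r $ Inl j > 0 \<longrightarrow> \<bar>affine_form Y z a j\<bar> < 2 powr (- (1 + e) * real k * r $ Inl j))"

text \<open>
  A row of weight \<open>0\<close> only imposes \<open>\<bar>Y\<^sub>j q + z\<^sub>j - p\<^sub>j\<bar> < 1\<close>, which \<open>p\<^sub>j = \<lfloor>Y\<^sub>j q + z\<^sub>j\<rfloor>\<close> always
  solves; normalising \<open>p\<^sub>j\<close> to \<open>0\<close> there makes approximating pairs unique.
\<close>
definition admissible :: "real ^ ('m + 'n) \<Rightarrow> nat \<Rightarrow> ((int ^ 'n) \<times> (int ^ 'm)) set" where
  "admissible r k = {a. fst a \<noteq> 0 \<and> (\<forall>i. \<bar>real_of_int (fst a $ i)\<bar> < 2 powr (real k * r $ Inr i)) \<and>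
     (\<forall>j. r $ Inl j = 0 \<longrightarrow> snd a $ j = 0)}"

text \<open>Forwards, \<open>Q\<close> is rounded up to a power of 2, and \<open>\<epsilon>\<close>
  is lowered to some \<open>1 / Suc l\<close> to pay for this in the rows; backwards,
  \<open>Q = 2^k\<close>. With countably many exponents and heights, measurability and the joining
  of null sets become available.\<close>

lemma VWA_iff_dyadic:
  fixes r :: "real ^ ('m::finite + 'n::finite)" and Y :: "real ^ 'n ^ 'm"
  assumes r: "\<And>k. r $ k \<ge> 0"
  shows "VWA r Y z \<longleftrightarrow>
    (\<exists>l. \<exists>\<^sub>\<infinity>k. \<exists>a\<in>admissible r k. dyadic_approx r (1 / real (Suc l)) k Y z a)"
proof
  assume "VWA r Y z"
  then obtain \<epsilon> where \<epsilon>: "\<epsilon> > 0" and *: "\<forall>Q0::real. \<exists>Q>Q0. Q > 1 \<and>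
        (\<exists>(q::int ^ 'n) (p::int ^ 'm). q \<noteq> 0 \<and>
           (\<forall>j. \<bar>(\<Sum>i\<in>UNIV. Y $ j $ i * real_of_int (q $ i)) + z $ j - real_of_int (p $ j)\<bar>
                  < Q powr (- (1 + \<epsilon>) * r $ Inl j)) \<and>
           (\<forall>i. \<bar>real_of_int (q $ i)\<bar> < Q powr (r $ Inr i)))"
    unfolding VWA_def by auto
  obtain l where "inverse (real (Suc l)) < \<epsilon>"
    using reals_Archimedean \<epsilon> by blast
  then have l: "1 / real (Suc l) < \<epsilon>" by (simp add: inverse_eq_divide)
  define e where "e = 1 / real (Suc l)"
  have e: "e < \<epsilon>" using l by (simp add: e_def)
  \<comment> \<open>Chosen so that \<open>(1 + e) * k \<le> (1 + \<epsilon>) * (k - 1)\<close> for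
    \<open>k \<ge> K1\<close>: rounding up only guarantees \<open>Q > 2^(k - 1)\<close>.\<close>
  obtain K1 :: nat where K1: "real K1 \<ge> (1 + \<epsilon>) / (\<epsilon> - e)"
    using real_arch_simple by blast
  have "\<exists>k\<ge>K. \<exists>a\<in>admissible r k. dyadic_approx r e k Y z a" for K
  proof -
    obtain Q q p where Q: "Q > 2 powr (real (K + K1))" "Q > 1" and q: "q \<noteq> 0"
      and approx: "\<And>j. \<bar>(\<Sum>i\<in>UNIV. Y $ j $ i * real_of_int (q $ i)) + z $ j - real_of_int (p $ j)\<bar>
                  < Q powr (- (1 + \<epsilon>) * r $ Inl j)"
      and height: "\<And>i. \<bar>real_of_int (q $ i)\<bar> < Q powr (r $ Inr i)"
      using * by meson
    define k where "k = nat \<lceil>log 2 Q\<rceil>"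
    have log: "log 2 Q > K + K1" using Q by (simp add: less_log_iff)
    then have k: "log 2 Q \<le> k" "k - 1 < log 2 Q" unfolding k_def by linarith+
    have kK: "k \<ge> K" "real k \<ge> K1" using log k by linarith+
    have Qp: "Q powr t = 2 powr (log 2 Q * t)" for t
      using Q by (simp add: powr_powr[symmetric])
    define a where "a = (q, \<chi> j. if r $ Inl j = 0 then 0 else p $ j)"
    have "a \<in> admissible r k"
      unfolding admissible_def
    proof (intro CollectI conjI allI impI)
      fix i
      have "Q powr (r $ Inr i) \<le> 2 powr (real k * r $ Inr i)"
        unfolding Qp using k r by (intro powr_mono mult_right_mono) auto
      then show "\<bar>real_of_int (fst a $ i)\<bar> < 2 powr (real k * r $ Inr i)"
        using height[of i] by (simp add: a_def)
    qed (use q in \<open>auto simp: a_def\<close>)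
    moreover have "dyadic_approx r e k Y z a"
      unfolding dyadic_approx_def
    proof (intro allI impI)
      fix j assume j: "r $ Inl j > 0"
      have "(1 + \<epsilon>) \<le> (\<epsilon> - e) * real k"
      proof -
        have "(1 + \<epsilon>) / (\<epsilon> - e) \<le> real k" using K1 kK by linarith
        then show ?thesis using e by (simp add: pos_divide_le_eq mult.commute)
      qed
      then have "(1 + e) * real k \<le> (1 + \<epsilon>) * (real k - 1)" by (simp add: algebra_simps)
      also have "\<dots> \<le> (1 + \<epsilon>) * log 2 Q"
        using k \<epsilon> by (intro mult_left_mono) auto
      finally have "(1 + e) * real k * r $ Inl j \<le> (1 + \<epsilon>) * log 2 Q * r $ Inl j"
        using j by (intro mult_right_mono) auto
      then have "Q powr (- (1 + \<epsilon>) * r $ Inl j) \<le> 2 powr (- (1 + e) * real k * r $ Inl j)"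
        unfolding Qp by (intro powr_mono) (auto simp: algebra_simps)
      then show "\<bar>affine_form Y z a j\<bar> < 2 powr (- (1 + e) * real k * r $ Inl j)"
        using approx[of j] j by (simp add: affine_form_def a_def)
    qed
    ultimately show ?thesis using kK by blast
  qed
  then show "\<exists>l. \<exists>\<^sub>\<infinity>k. \<exists>a\<in>admissible r k. dyadic_approx r (1 / real (Suc l)) k Y z a"
    unfolding INFM_nat_le e_def by blast
next
  assume "\<exists>l. \<exists>\<^sub>\<infinity>k. \<exists>a\<in>admissible r k. dyadic_approx r (1 / real (Suc l)) k Y z a"
  then obtain l where l: "\<exists>\<^sub>\<infinity>k. \<exists>a\<in>admissible r k. dyadic_approx r (1 / real (Suc l)) k Y z a" ..
  define e where "e = 1 / real (Suc l)"
  show "VWA r Y z"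
    unfolding VWA_def
  proof (rule exI[of _ e], intro conjI allI)
    show "e > 0" by (simp add: e_def)
    fix Q0 :: real
    obtain K :: nat where K: "real K \<ge> Q0" using real_arch_simple by blast
    \<comment> \<open>\<open>Suc K\<close> forces \<open>k > 0\<close>, hence
      \<open>2 powr k > 1\<close>.\<close>
    obtain k a where k: "k \<ge> Suc K" and a: "a \<in> admissible r k" and approx: "dyadic_approx r e k Y z a"
      using l unfolding INFM_nat_le e_def by blast
    \<comment> \<open>Rows of weight 0, where admissibility put the entry 0, get back the floor,
      whose error is below \<open>1 = Q powr 0\<close>.\<close>
    define p where "p = (\<chi> j. if r $ Inl j = 0
      then \<lfloor>(\<Sum>i\<in>UNIV. Y $ j $ i * real_of_int (fst a $ i)) + z $ j\<rfloor> else snd a $ j)"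
    have Q: "2 powr real k > Q0" "2 powr real k > 1"
    proof -
      have "real K < 2 ^ k"
        by (meson k less_le_trans of_nat_less_two_power one_le_numeral power_increasing Suc_leD)
      moreover have "2 powr real k = 2 ^ k" by (rule powr_realpow) simp
      ultimately show "2 powr real k > Q0" using K by linarith
      show "2 powr real k > 1" using k by (intro gr_one_powr) auto
    qed
    have "\<bar>(\<Sum>i\<in>UNIV. Y $ j $ i * real_of_int (fst a $ i)) + z $ j - real_of_int (p $ j)\<bar>
        < (2 powr real k) powr (- (1 + e) * r $ Inl j)" for j
    proof (cases "r $ Inl j = 0")
      case True
      then show ?thesis
        using Q by (simp add: p_def) linarith
    next
      case False
      then have "r $ Inl j > 0" using r[of "Inl j"] by simp
      then show ?thesis
        using approx False unfolding dyadic_approx_def affine_form_def p_def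
        by (auto simp: powr_powr mult_ac)
    qed
    moreover have "\<bar>real_of_int (fst a $ i)\<bar> < (2 powr real k) powr (r $ Inr i)" for i
      using a by (simp add: admissible_def powr_powr)
    moreover have "fst a \<noteq> 0" using a by (simp add: admissible_def)
    ultimately show "\<exists>Q>Q0. Q > 1 \<and>
        (\<exists>(q::int ^ 'n) (p::int ^ 'm). q \<noteq> 0 \<and>
           (\<forall>j. \<bar>(\<Sum>i\<in>UNIV. Y $ j $ i * real_of_int (q $ i)) + z $ j - real_of_int (p $ j)\<bar>
                  < Q powr (- (1 + e) * r $ Inl j)) \<and>
           (\<forall>i. \<bar>real_of_int (q $ i)\<bar> < Q powr (r $ Inr i)))"
      using Q by blast
  qed
qed

lemma open_dyadic_approx: "open {Y. dyadic_approx r e k Y z a}"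
proof -
  have "{Y. dyadic_approx r e k Y z a} =
    (\<Inter>j\<in>{j. r $ Inl j > 0}. {Y. \<bar>affine_form Y z a j\<bar> < 2 powr (- (1 + e) * real k * r $ Inl j)})"
    by (auto simp: dyadic_approx_def)
  also have "open \<dots>"
    unfolding affine_form_def
    by (intro open_INT finite ballI open_Collect_less continuous_intros)
  finally show ?thesis .
qed

text \<open>The dyadic form is a countable combination of open conditions. Measurability lets the
  almost-everywhere statement about \<open>F x\<close> be carried over to the pushforward.\<close>

lemma VWA_measurable:
  fixes r :: "real ^ ('m::finite + 'n::finite)"
  assumes "\<And>k. r $ k \<ge> 0"
  shows "{Y. VWA r Y z} \<in> sets borel"
proof -
  have "{Y. VWA r Y z} = (\<Union>l. \<Inter>K. \<Union>k\<in>{K..}. \<Union>a\<in>admissible r k.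
      {Y. dyadic_approx r (1 / real (Suc l)) k Y z a})"
    by (simp add: set_eq_iff VWA_iff_dyadic[OF assms] INFM_nat_le Bex_def)
  also have "\<dots> \<in> sets borel"
    by (intro sets.countable_UN' sets.countable_INT image_subsetI countableI_type borel_open open_dyadic_approx) auto
  finally show ?thesis .
qed

lemma dyadic_approx_mono:
  assumes "dyadic_approx r e k Y z a" "e' \<le> e"
  shows "dyadic_approx r e' k Y z a"
  unfolding dyadic_approx_def
proof (intro allI impI)
  fix j assume j: "r $ Inl j > 0"
  then have "2 powr (- (1 + e) * real k * r $ Inl j) \<le> (2::real) powr (- (1 + e') * real k * r $ Inl j)"
    using assms(2) by (intro powr_mono mult_right_mono) auto
  then show "\<bar>affine_form Y z a j\<bar> < 2 powr (- (1 + e') * real k * r $ Inl j)"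
    using assms(1) j unfolding dyadic_approx_def by (meson less_le_trans)
qed

text \<open>Subtraction cancels \<open>z\<close> and at most doubles the bounds. Going up
  \<open>c\<close> levels makes room for the doubled heights, and the smaller exponent
  \<open>e'\<close> absorbs the loss in the rows once \<open>k\<close> is large.\<close>

lemma dyadic_approx_difference:
  fixes r :: "real ^ ('m::finite + 'n::finite)"
  assumes r: "\<And>k. r $ k \<ge> 0" and e: "0 < e'" "e' < e"
  obtains c k0 where "\<And>k Y z a b. k \<ge> k0 \<Longrightarrow> a \<in> admissible r k \<Longrightarrow> b \<in> admissible r k \<Longrightarrow> a \<noteq> b \<Longrightarrow>
    dyadic_approx r e k Y z a \<Longrightarrow> dyadic_approx r e k Y z b \<Longrightarrow>
    \<exists>d\<in>admissible r (k + c). dyadic_approx r e' (k + c) Y 0 d"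
proof -
  \<comment> \<open>Every positive weight then satisfies \<open>2 powr (c * r $ i) \<ge> 2\<close>;
    zero weights enter the maximum as \<open>inverse 0 = 0\<close>.\<close>
  obtain c :: nat where c: "real c \<ge> Max (range (\<lambda>i. inverse (r $ i)))"
    using real_arch_simple by blast
  have cr: "real c * r $ i \<ge> 1" if "r $ i > 0" for i
  proof -
    have "inverse (r $ i) \<le> Max (range (\<lambda>i. inverse (r $ i)))" by (intro Max_ge) auto
    then have "inverse (r $ i) * r $ i \<le> real c * r $ i"
      using c that by (intro mult_right_mono) auto
    then show ?thesis using that by simp
  qed
  \<comment> \<open>Large enough for \<open>(1 + e') * (k + c) \<le> (1 + e) * k - c\<close>, where
    the last term pays for the factor 2 in the rows.\<close>
  obtain k1 :: nat where k1: "real k1 \<ge> real c * (2 + e') / (e - e')"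
    using real_arch_simple by blast
  have "\<exists>d\<in>admissible r (k + c). dyadic_approx r e' (k + c) Y 0 d"
    if k: "k \<ge> max c k1" and a: "a \<in> admissible r k" and b: "b \<in> admissible r k" and "a \<noteq> b"
      and Ya: "dyadic_approx r e k Y z a" and Yb: "dyadic_approx r e k Y z b" for k Y z a b
  proof (intro bexI)
    define d where "d = (fst a - fst b, snd a - snd b)"
    have lin: "affine_form Y 0 d j = affine_form Y z a j - affine_form Y z b j" for j
      by (simp add: d_def affine_form_def algebra_simps sum_subtractf)
    have main: "real c * (2 + e') \<le> (e - e') * real k"
    proof -
      have "real c * (2 + e') / (e - e') \<le> real k" using k1 k by linarith
      then show ?thesis using e by (simp add: pos_divide_le_eq mult.commute)
    qed
    have small: "\<bar>affine_form Y 0 d j\<bar> < 2 powr (1 - (1 + e) * real k * r $ Inl j)"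
      if "r $ Inl j > 0" for j
    proof -
      have "\<bar>affine_form Y z a j\<bar> < 2 powr (- (1 + e) * real k * r $ Inl j)"
        "\<bar>affine_form Y z b j\<bar> < 2 powr (- (1 + e) * real k * r $ Inl j)"
        using Ya Yb that unfolding dyadic_approx_def by auto
      then have "\<bar>affine_form Y 0 d j\<bar> < 2 * 2 powr (- (1 + e) * real k * r $ Inl j)"
        unfolding lin by linarith
      also have "\<dots> = 2 powr (1 + (- (1 + e) * real k * r $ Inl j))"
        by (subst powr_add) simp
      also have "1 + (- (1 + e) * real k * r $ Inl j) = 1 - (1 + e) * real k * r $ Inl j"
        by (simp add: algebra_simps)
      finally show ?thesis .
    qed
    show "dyadic_approx r e' (k + c) Y 0 d"
      unfolding dyadic_approx_def
    proof (intro allI impI)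
      fix j assume j: "r $ Inl j > 0"
      have "(1 + e') * real (k + c) \<le> (1 + e) * real k - real c"
        using main by (simp add: algebra_simps)
      then have "(1 + e') * real (k + c) * r $ Inl j \<le> ((1 + e) * real k - real c) * r $ Inl j"
        using j by (intro mult_right_mono) auto
      also have "\<dots> \<le> (1 + e) * real k * r $ Inl j - 1"
        using cr[OF j] by (simp add: algebra_simps)
      finally have "2 powr (1 - (1 + e) * real k * r $ Inl j)
          \<le> (2::real) powr (- (1 + e') * real (k + c) * r $ Inl j)"
        by (intro powr_mono) (auto simp: algebra_simps)
      with small[OF j] show "\<bar>affine_form Y 0 d j\<bar> < 2 powr (- (1 + e') * real (k + c) * r $ Inl j)"
        by linarith
    qed
    show "d \<in> admissible r (k + c)"
      unfolding admissible_def
    proof (intro CollectI conjI allI impI)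
      \<comment> \<open>If the \<open>q\<close> parts agree, the integers \<open>p\<close> differ by
        less than 1 in rows of positive weight, because \<open>k \<ge> c\<close>, and are both 0 in
        the other rows; then \<open>a = b\<close>.\<close>
      show "fst d \<noteq> 0"
      proof
        assume q: "fst d = 0"
        have "snd d $ j = 0" for j
        proof (cases "r $ Inl j = 0")
          case True
          then show ?thesis using a b by (auto simp: d_def admissible_def)
        next
          case False
          then have j: "r $ Inl j > 0" using r[of "Inl j"] by simp
          have "1 * 1 \<le> (1 + e) * (real c * r $ Inl j)"
            using cr[OF j] e by (intro mult_mono) auto
          also have "\<dots> = (1 + e) * real c * r $ Inl j" by simp
          also have "\<dots> \<le> (1 + e) * real k * r $ Inl j"
            using k e j by (intro mult_right_mono mult_left_mono) auto
          finally have "2 powr (1 - (1 + e) * real k * r $ Inl j) \<le> (2::real) powr 0"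
            by (intro powr_mono) auto
          with small[OF j] have "\<bar>real_of_int (snd d $ j)\<bar> < 1"
            by (simp add: affine_form_def q)
          then show ?thesis by linarith
        qed
        then have "snd d = 0" by (simp add: vec_eq_iff)
        with q \<open>a \<noteq> b\<close> show False by (simp add: d_def prod_eq_iff)
      qed
      fix i
      show "\<bar>real_of_int (fst d $ i)\<bar> < 2 powr (real (k + c) * r $ Inr i)"
      proof -
        have ai: "\<bar>real_of_int (fst a $ i)\<bar> < 2 powr (real k * r $ Inr i)"
          and bi: "\<bar>real_of_int (fst b $ i)\<bar> < 2 powr (real k * r $ Inr i)"
          using a b by (auto simp: admissible_def)
        show ?thesis
        proof (cases "r $ Inr i = 0")
          case True
          \<comment> \<open>An integer of absolute value below \<open>2 powr 0 = 1\<close> vanishes,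
            so the height bound survives without room for doubling.\<close>
          then have "fst a $ i = 0" "fst b $ i = 0" using ai bi by auto
          then show ?thesis by (simp add: d_def)
        next
          case False
          then have i: "r $ Inr i > 0" using r[of "Inr i"] by simp
          have "\<bar>real_of_int (fst d $ i)\<bar> < 2 * 2 powr (real k * r $ Inr i)"
            using ai bi by (simp add: d_def)
          also have "\<dots> = 2 powr (1 + real k * r $ Inr i)"
            by (subst powr_add) simp
          also have "\<dots> \<le> 2 powr (real (k + c) * r $ Inr i)"
            using cr[OF i] by (intro powr_mono) (auto simp: algebra_simps)
          finally show ?thesis .
        qed
      qed
    qed (use a b in \<open>auto simp: d_def admissible_def\<close>)
  qed
  then show ?thesis using that by blast
qed

subsection \<open>The contraction property from goodness and non-planarity\<close>

text \<open>By compactness: otherwise normals scaled to norm 1, with offsets bounded through a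
  single point of \<open>S\<close>, accumulate at a hyperplane containing the image of
  \<open>S\<close>. Uniformity in \<open>a\<close> and \<open>b\<close> makes one \<open>c\<close>
  serve all integer pairs.\<close>

lemma nonplanar_lower_bound:
  fixes f :: "'a \<Rightarrow> real ^ 'n"
  assumes "S \<noteq> {}" and nonplanar: "\<not> (\<exists>a b. a \<noteq> 0 \<and> f ` S \<subseteq> {v. a \<bullet> v = b})"
  shows "\<exists>c>0. \<forall>a b. norm a \<ge> 1 \<longrightarrow> (\<exists>y\<in>S. c \<le> \<bar>b + a \<bullet> f y\<bar>)"
proof (rule ccontr)
  assume contra: "\<not> ?thesis"
  have "\<exists>a b. norm a = 1 \<and> (\<forall>y\<in>S. \<bar>b + a \<bullet> f y\<bar> < 1 / real (Suc n))" for n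
  proof -
    obtain a b where a: "norm a \<ge> 1" and ab: "\<forall>y\<in>S. \<bar>b + a \<bullet> f y\<bar> < 1 / real (Suc n)"
    proof -
      have "0 < 1 / real (Suc n)" by simp
      then have "\<not> (\<forall>a b. norm a \<ge> 1 \<longrightarrow> (\<exists>y\<in>S. 1 / real (Suc n) \<le> \<bar>b + a \<bullet> f y\<bar>))"
        using contra by blast
      then show ?thesis using that by (auto simp: not_le)
    qed
    \<comment> \<open>Since \<open>norm a \<ge> 1\<close>, normalising does not increase the
      values.\<close>
    have "\<bar>b / norm a + (a /\<^sub>R norm a) \<bullet> f y\<bar> < 1 / real (Suc n)" if "y \<in> S" for y
    proof -
      have "b / norm a + (a /\<^sub>R norm a) \<bullet> f y = (b + a \<bullet> f y) / norm a"
        by (simp add: divide_inverse algebra_simps)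
      also have "\<bar>\<dots>\<bar> = \<bar>b + a \<bullet> f y\<bar> / norm a" by simp
      also have "\<dots> \<le> \<bar>b + a \<bullet> f y\<bar>"
        using a by (intro divide_le_eq[THEN iffD2]) (auto simp: mult_le_cancel_left1)
      finally show ?thesis using ab that by fastforce
    qed
    moreover have "norm (a /\<^sub>R norm a) = 1"
    proof -
      have "norm a \<noteq> 0" using a by linarith
      then show ?thesis by simp
    qed
    ultimately show ?thesis by blast
  qed
  then obtain a b where a: "\<And>n. norm (a n) = 1"
    and ab: "\<And>n y. y \<in> S \<Longrightarrow> \<bar>b n + a n \<bullet> f y\<bar> < 1 / real (Suc n)"
    by metis
  obtain y0 where y0: "y0 \<in> S" using assms(1) by auto
  have b: "norm (b n) \<le> 1 + norm (f y0)" for n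
  proof -
    have "\<bar>b n + a n \<bullet> f y0\<bar> < 1"
      using ab[OF y0, of n] by (rule less_le_trans) simp
    moreover have "\<bar>a n \<bullet> f y0\<bar> \<le> norm (f y0)"
      using Cauchy_Schwarz_ineq2[of "a n" "f y0"] a[of n] by simp
    ultimately show ?thesis by simp
  qed
  have "seq_compact (sphere (0::real ^ 'n) 1 \<times> cball (0::real) (1 + norm (f y0)))"
    by (intro compact_imp_seq_compact compact_Times) auto
  moreover have "\<forall>n. (a n, b n) \<in> sphere (0::real ^ 'n) 1 \<times> cball (0::real) (1 + norm (f y0))"
    using a b by auto
  ultimately obtain l h where l: "l \<in> sphere (0::real ^ 'n) 1 \<times> cball (0::real) (1 + norm (f y0))"
    and h: "strict_mono h" "((\<lambda>n. (a n, b n)) \<circ> h) \<longlonglongrightarrow> l"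
    by (rule seq_compactE)
  obtain a' b' where l': "l = (a', b')" by (cases l)
  have lim: "(\<lambda>n. a (h n)) \<longlonglongrightarrow> a'" "(\<lambda>n. b (h n)) \<longlonglongrightarrow> b'"
    using tendsto_fst[OF h(2)] tendsto_snd[OF h(2)] by (auto simp: l' o_def)
  have "b' + a' \<bullet> f y = 0" if "y \<in> S" for y
  proof -
    have "(\<lambda>n. \<bar>b (h n) + a (h n) \<bullet> f y\<bar>) \<longlonglongrightarrow> \<bar>b' + a' \<bullet> f y\<bar>"
      by (intro tendsto_intros lim)
    moreover have "(\<lambda>n. \<bar>b (h n) + a (h n) \<bullet> f y\<bar>) \<longlonglongrightarrow> 0"
    proof (rule Lim_null_comparison)
      show "(\<lambda>n. 1 / real (Suc (h n))) \<longlonglongrightarrow> 0"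
        using LIMSEQ_subseq_LIMSEQ[OF LIMSEQ_inverse_real_of_nat h(1)]
        by (simp add: o_def inverse_eq_divide)
      show "\<forall>\<^sub>F n in sequentially. norm \<bar>b (h n) + a (h n) \<bullet> f y\<bar> \<le> 1 / real (Suc (h n))"
        using ab[OF that] by (intro always_eventually allI) (simp del: of_nat_Suc add: less_imp_le)
    qed
    ultimately have "\<bar>b' + a' \<bullet> f y\<bar> = 0" using LIMSEQ_unique by blast
    then show ?thesis by simp
  qed
  then have "f ` S \<subseteq> {v. a' \<bullet> v = - b'}" by (auto simp: eq_neg_iff_add_eq_0 add.commute)
  moreover have "a' \<noteq> 0" using l l' by auto
  ultimately show False using nonplanar by blast
qed

definition real_vec :: "int ^ 'n \<Rightarrow> real ^ 'n" where
  "real_vec q = (\<chi> i. real_of_int (q $ i))"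

lemma norm_real_vec_ge_1:
  assumes "q \<noteq> 0"
  shows "norm (real_vec q) \<ge> 1"
proof -
  obtain i where "q $ i \<noteq> 0" using assms by (auto simp: vec_eq_iff)
  then have "1 \<le> \<bar>real_vec q $ i\<bar>" by (simp add: real_vec_def)
  also have "\<dots> \<le> norm (real_vec q)" using component_le_norm_cart[of "real_vec q" i] by simp
  finally show ?thesis .
qed

text \<open>This is the shape to which goodness and non-planarity apply: a constant plus a linear
  form in the row.\<close>

lemma affine_form_eq:
  "affine_form Y z a j = (z $ j - real_of_int (snd a $ j)) + real_vec (fst a) \<bullet> Y $ j"
  by (simp add: affine_form_def real_vec_def inner_vec_def mult.commute)

text \<open>Replaces the supremum in the goodness inequality by a positive real lower bound for it;
  an infinite supremum makes the ratio 0.\<close>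

lemma ennreal_powr_ratio_le:
  assumes "\<epsilon> > 0" "h > 0" "\<alpha> > 0" "ennreal h \<le> S"
  shows "ennreal_powr (ennreal \<epsilon> / S) \<alpha> \<le> ennreal ((\<epsilon> / h) powr \<alpha>)"
proof -
  have le: "ennreal \<epsilon> / S \<le> ennreal (\<epsilon> / h)"
  proof (cases S)
    case (real t)
    then have "h \<le> t" using assms by simp
    then show ?thesis
      using assms real by (simp add: divide_ennreal ennreal_leI frac_le)
  qed simp
  then have "enn2real (ennreal \<epsilon> / S) \<le> \<epsilon> / h"
    using assms by (intro enn2real_leI) auto
  then have "enn2real (ennreal \<epsilon> / S) powr \<alpha> \<le> (\<epsilon> / h) powr \<alpha>"
    using assms by (intro powr_mono2) auto
  moreover have "ennreal \<epsilon> / S \<noteq> \<infinity>" using le by (auto simp: top_unique)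
  ultimately show ?thesis by (simp add: ennreal_powr_def ennreal_leI)
qed

text \<open>Starting from \<open>2 * \<rho>\<close>, the radius is divided by 9 until the support
  part of the ball lies in the set of exponent \<open>e'\<close>. The ball just before, of radius
  \<open>9 * s\<close>, has a support point where some row reaches its \<open>e'\<close> threshold,
  and goodness of that row bounds the proportion of the set of exponent \<open>e\<close>. As
  \<open>x\<close> is within \<open>\<rho>\<close> of \<open>x0\<close>, everything stays in
  \<open>ball x0 (3 * \<rho>)\<close>.\<close>

lemma contracting_balls:
  fixes F :: "'a::euclidean_space \<Rightarrow> real ^ 'n ^ 'm" and r :: "real ^ ('m + 'n)"
  assumes U: "open U" "space M = U" "\<And>T. open T \<Longrightarrow> T \<inter> U \<in> sets M"
    and F: "continuous_on U F"
    and j0: "r $ Inl j0 > 0"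
    and x0: "x0 \<in> msupp M" and \<rho>: "\<rho> > 0" and V: "ball x0 (3 * \<rho>) \<subseteq> U"
    and C: "\<And>j. C j > 0" and \<alpha>: "\<And>j. \<alpha> j > 0"
    and good: "\<And>j (c0::real) c. good_fun_on (C j) (\<alpha> j) (ball x0 (3 * \<rho>)) M (\<lambda>y. c0 + c \<bullet> F y $ j)"
    and nonplanar: "nonplanar_on U (\<lambda>x. F x $ j0) M"
    and e: "0 < e'" "e' < e"
  shows "\<exists>k0. \<forall>k\<ge>k0. \<forall>a\<in>admissible r k.
     \<forall>x\<in>{x\<in>U. dyadic_approx r e k (F x) z a} \<inter> msupp M \<inter> ball x0 \<rho>.
     \<exists>s>0. s \<le> 2 * \<rho> \<and> ball x (9 * s) \<subseteq> ball x0 (3 * \<rho>) \<and>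
       ball x s \<inter> msupp M \<subseteq> {x\<in>U. dyadic_approx r e' k (F x) z a} \<and>
       emeasure M ({x\<in>U. dyadic_approx r e k (F x) z a} \<inter> ball x (9 * s))
       \<le> ennreal (\<Sum>j | r $ Inl j > 0. C j * (2 powr (- (e - e') * real k * r $ Inl j)) powr \<alpha> j)
          * emeasure M (ball x (9 * s))"
proof -
  have "ball x0 \<rho> \<subseteq> ball x0 (3 * \<rho>)" using \<rho> by (intro subset_ball) auto
  then have "ball x0 \<rho> \<subseteq> U" using V by blast
  then have np: "\<not> (\<exists>a b. a \<noteq> 0 \<and> (\<lambda>x. F x $ j0) ` (ball x0 \<rho> \<inter> msupp M) \<subseteq> {v. a \<bullet> v = b})"
    using nonplanar x0 \<rho> unfolding nonplanar_on_def by blast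
  have "ball x0 \<rho> \<inter> msupp M \<noteq> {}" using x0 \<rho> centre_in_ball[of x0 \<rho>] by blast
  with nonplanar_lower_bound[OF _ np] obtain c where c: "c > 0"
    and c_le: "\<And>a b. norm a \<ge> 1 \<Longrightarrow> \<exists>y\<in>ball x0 \<rho> \<inter> msupp M. c \<le> \<bar>b + a \<bullet> F y $ j0\<bar>"
    by blast
  \<comment> \<open>From \<open>k0\<close> on, the \<open>e'\<close> threshold of row
    \<open>j0\<close> is at most \<open>c\<close>, so no admissible pair meets it on the whole
    support in \<open>ball x0 \<rho>\<close>.\<close>
  obtain k0 :: nat where k0: "real k0 \<ge> - log 2 c / r $ Inl j0"
    using real_arch_simple by blast
  have c_gt: "2 powr (- (1 + e') * real k * r $ Inl j0) \<le> c" if "k \<ge> k0" for k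
  proof -
    have "- log 2 c / r $ Inl j0 \<le> real k" using k0 that by linarith
    then have "- log 2 c \<le> 1 * real k * r $ Inl j0" unfolding pos_divide_le_eq[OF j0] by simp
    also have "\<dots> \<le> (1 + e') * real k * r $ Inl j0"
      using e j0 by (intro mult_right_mono) auto
    finally have "- (1 + e') * real k * r $ Inl j0 \<le> log 2 c" by (simp add: algebra_simps)
    then have "2 powr (- (1 + e') * real k * r $ Inl j0) \<le> 2 powr (log 2 c)"
      by (intro powr_mono) auto
    then show ?thesis using c by simp
  qed
  define \<kappa> where "\<kappa> k = (\<Sum>j | r $ Inl j > 0. C j * (2 powr (- (e - e') * real k * r $ Inl j)) powr \<alpha> j)" for k
  define L where "L e k a = {x\<in>U. dyadic_approx r e k (F x) z a}" for e k a
  have "\<forall>k\<ge>k0. \<forall>a\<in>admissible r k. \<forall>x\<in>L e k a \<inter> msupp M \<inter> ball x0 \<rho>.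
       \<exists>s>0. s \<le> 2 * \<rho> \<and> ball x (9 * s) \<subseteq> ball x0 (3 * \<rho>) \<and> ball x s \<inter> msupp M \<subseteq> L e' k a \<and>
       emeasure M (L e k a \<inter> ball x (9 * s)) \<le> ennreal (\<kappa> k) * emeasure M (ball x (9 * s))"
  proof (intro allI impI ballI)
    fix k a x
    assume k: "k \<ge> k0" and a: "a \<in> admissible r k" and x: "x \<in> L e k a \<inter> msupp M \<inter> ball x0 \<rho>"
    have "open (L e' k a)"
    proof -
      have "L e' k a = U \<inter> F -` {Y. dyadic_approx r e' k Y z a}" by (auto simp: L_def)
      then show ?thesis
        using continuous_open_preimage[OF F U(1) open_dyadic_approx] by simp
    qed
    moreover have "x \<in> L e' k a"
      using x e dyadic_approx_mono[of r e k "F x" z a e'] by (auto simp: L_def)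
    ultimately obtain \<delta> where \<delta>: "\<delta> > 0" "ball x \<delta> \<subseteq> L e' k a"
      by (rule openE)
    define P where "P n \<longleftrightarrow> ball x (2 * \<rho> / 9 ^ n) \<inter> msupp M \<subseteq> L e' k a" for n :: nat
    have "\<exists>n. P n"
    proof -
      obtain n where "(1 / 9 :: real) ^ n < \<delta> / (2 * \<rho>)"
        using real_arch_pow_inv[of "\<delta> / (2 * \<rho>)" "1 / 9"] \<delta> \<rho> by auto
      then have "2 * \<rho> / 9 ^ n \<le> \<delta>" using \<rho> by (simp add: field_simps)
      then have "ball x (2 * \<rho> / 9 ^ n) \<subseteq> ball x \<delta>" by (rule subset_ball)
      then show ?thesis using \<delta> unfolding P_def by blast
    qed
    \<comment> \<open>\<open>ball x (2 * \<rho>)\<close> contains \<open>ball x0 \<rho>\<close>,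
      where non-planarity provides a support point violating row \<open>j0\<close>.\<close>
    moreover have "\<not> P 0"
    proof
      assume "P 0"
      have "norm (real_vec (fst a)) \<ge> 1"
        using a by (intro norm_real_vec_ge_1) (simp add: admissible_def)
      from c_le[OF this, of "z $ j0 - real_of_int (snd a $ j0)"]
      obtain y where y: "y \<in> ball x0 \<rho>" "y \<in> msupp M" "c \<le> \<bar>affine_form (F y) z a j0\<bar>"
        by (auto simp: affine_form_eq)
      have "dist x y \<le> dist x x0 + dist x0 y" by (rule dist_triangle)
      then have "y \<in> ball x (2 * \<rho>)" using y x by (auto simp: dist_commute)
      then have "y \<in> L e' k a" using \<open>P 0\<close> y by (auto simp: P_def)
      then have "\<bar>affine_form (F y) z a j0\<bar> < 2 powr (- (1 + e') * real k * r $ Inl j0)"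
        using j0 by (auto simp: L_def dyadic_approx_def)
      then show False using y(3) c_gt[OF k] by linarith
    qed
    ultimately obtain n where n: "\<not> P n" "P (Suc n)"
      using exists_least_lemma[of P] by blast
    define s where "s = 2 * \<rho> / 9 ^ Suc n"
    have s: "s > 0" "9 * s = 2 * \<rho> / 9 ^ n" using \<rho> by (auto simp: s_def)
    have "9 * s \<le> 2 * \<rho>" unfolding s using \<rho> by (simp add: divide_le_eq mult_le_cancel_left1)
    then have s_le: "s \<le> 2 * \<rho>" "9 * s \<le> 2 * \<rho>" using s(1) by auto
    have B: "ball x (9 * s) \<subseteq> ball x0 (3 * \<rho>)"
    proof
      fix y assume "y \<in> ball x (9 * s)"
      moreover have "dist x0 y \<le> dist x0 x + dist x y" by (rule dist_triangle)
      ultimately show "y \<in> ball x0 (3 * \<rho>)" using x s_le by auto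
    qed
    obtain y where y: "y \<in> ball x (9 * s)" "y \<in> msupp M" "y \<notin> L e' k a"
      using n(1) unfolding P_def s(2)[symmetric] by blast
    then have "y \<in> U" using B V by blast
    \<comment> \<open>The violated row depends on the ball, so \<open>\<kappa>\<close> sums the
      bounds of all rows of positive weight.\<close>
    with y obtain j where j: "r $ Inl j > 0"
      and lower: "2 powr (- (1 + e') * real k * r $ Inl j) \<le> \<bar>affine_form (F y) z a j\<bar>"
      by (auto simp: L_def dyadic_approx_def not_less)
    define h where "h = 2 powr (- (1 + e') * real k * r $ Inl j)"
    define \<epsilon> where "\<epsilon> = 2 powr (- (1 + e) * real k * r $ Inl j)"
    have \<epsilon>h: "\<epsilon> > 0" "h > 0" by (auto simp: \<epsilon>_def h_def)
    have ratio: "\<epsilon> / h = 2 powr (- (e - e') * real k * r $ Inl j)"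
      by (simp add: \<epsilon>_def h_def powr_diff[symmetric] algebra_simps)
    define S where "S = (SUP y\<in>ball x (9 * s) \<inter> msupp M. ennreal \<bar>affine_form (F y) z a j\<bar>)"
    have "ennreal h \<le> S"
    proof -
      have "ennreal h \<le> ennreal \<bar>affine_form (F y) z a j\<bar>"
        using lower by (intro ennreal_leI) (simp add: h_def)
      also have "\<dots> \<le> S" unfolding S_def using y by (intro SUP_upper) auto
      finally show ?thesis .
    qed
    have "emeasure M (L e k a \<inter> ball x (9 * s)) \<le> emeasure M {y \<in> ball x (9 * s). \<bar>affine_form (F y) z a j\<bar> < \<epsilon>}"
    proof (rule emeasure_mono)
      show "L e k a \<inter> ball x (9 * s) \<subseteq> {y \<in> ball x (9 * s). \<bar>affine_form (F y) z a j\<bar> < \<epsilon>}"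
        using j by (auto simp: L_def dyadic_approx_def \<epsilon>_def)
      have "open {Y. \<bar>affine_form Y z a j\<bar> < \<epsilon>}"
        unfolding affine_form_def by (intro open_Collect_less continuous_intros)
      then have "open (U \<inter> F -` {Y. \<bar>affine_form Y z a j\<bar> < \<epsilon>})"
        by (rule continuous_open_preimage[OF F U(1)])
      then have "open (ball x (9 * s) \<inter> (U \<inter> F -` {Y. \<bar>affine_form Y z a j\<bar> < \<epsilon>}))"
        by (rule open_Int[OF open_ball])
      from U(3)[OF this] show "{y \<in> ball x (9 * s). \<bar>affine_form (F y) z a j\<bar> < \<epsilon>} \<in> sets M"
      proof (rule back_subst[where P="\<lambda>X. X \<in> sets M"])
        show "ball x (9 * s) \<inter> (U \<inter> F -` {Y. \<bar>affine_form Y z a j\<bar> < \<epsilon>}) \<inter> U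
          = {y \<in> ball x (9 * s). \<bar>affine_form (F y) z a j\<bar> < \<epsilon>}"
          using B V by auto
      qed
    qed
    also have "\<dots> \<le> ennreal (C j) * ennreal_powr (ennreal \<epsilon> / S) (\<alpha> j) * emeasure M (ball x (9 * s))"
    proof -
      have x': "x \<in> msupp M" "9 * s > 0" using x s by auto
      show ?thesis
        using good[of j "z $ j - real_of_int (snd a $ j)" "real_vec (fst a)",
            unfolded good_fun_on_def affine_form_eq[symmetric], rule_format, OF x' B \<epsilon>h(1)]
        unfolding S_def .
    qed
    also have "\<dots> \<le> ennreal (\<kappa> k) * emeasure M (ball x (9 * s))"
    proof (rule mult_right_mono)
      have "ennreal (C j) * ennreal_powr (ennreal \<epsilon> / S) (\<alpha> j) \<le> ennreal (C j) * ennreal ((\<epsilon> / h) powr \<alpha> j)"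
        by (intro mult_left_mono ennreal_powr_ratio_le \<epsilon>h \<alpha> \<open>ennreal h \<le> S\<close>) auto
      also have "\<dots> = ennreal (C j * (2 powr (- (e - e') * real k * r $ Inl j)) powr \<alpha> j)"
        using C[of j] by (simp add: ennreal_mult ratio)
      also have "\<dots> \<le> ennreal (\<kappa> k)"
      proof (rule ennreal_leI)
        show "C j * (2 powr (- (e - e') * real k * r $ Inl j)) powr \<alpha> j \<le> \<kappa> k"
          unfolding \<kappa>_def using j C
          by (intro member_le_sum[where f="\<lambda>j. C j * (2 powr (- (e - e') * real k * r $ Inl j)) powr \<alpha> j"])
             (auto intro: less_imp_le)
      qed
      finally show "ennreal (C j) * ennreal_powr (ennreal \<epsilon> / S) (\<alpha> j) \<le> ennreal (\<kappa> k)" .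
    qed auto
    finally have "emeasure M (L e k a \<inter> ball x (9 * s)) \<le> ennreal (\<kappa> k) * emeasure M (ball x (9 * s))" .
    moreover have "ball x s \<inter> msupp M \<subseteq> L e' k a" using n(2) by (simp add: P_def s_def)
    ultimately show "\<exists>s>0. s \<le> 2 * \<rho> \<and> ball x (9 * s) \<subseteq> ball x0 (3 * \<rho>) \<and>
       ball x s \<inter> msupp M \<subseteq> L e' k a \<and>
       emeasure M (L e k a \<inter> ball x (9 * s)) \<le> ennreal (\<kappa> k) * emeasure M (ball x (9 * s))"
      using s s_le B by blast
  qed
  then show ?thesis unfolding \<kappa>_def L_def by (rule exI[of _ k0])
qed

text \<open>Each \<open>j\<close> contributes a geometric sequence in \<open>k\<close> of ratio
  \<open>2 powr (- (\<delta> * w j * \<alpha> j)) < 1\<close>.\<close>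

lemma summable_powr_decay:
  fixes w \<alpha> C :: "'j \<Rightarrow> real"
  assumes "\<delta> > 0" "\<And>j. j \<in> A \<Longrightarrow> w j > 0" "\<And>j. \<alpha> j > 0"
  shows "summable (\<lambda>k. \<Sum>j\<in>A. C j * (2 powr (- \<delta> * real k * w j)) powr \<alpha> j)"
proof (intro summable_sum summable_mult)
  fix j assume "j \<in> A"
  then have "0 < \<delta> * w j * \<alpha> j" using assms by simp
  then have "2 powr (- (\<delta> * w j * \<alpha> j)) < (2::real) powr 0"
    by (intro powr_less_mono) auto
  then have "summable (\<lambda>k. (2 powr (- (\<delta> * w j * \<alpha> j))) ^ k :: real)"
    by (intro summable_geometric) auto
  then show "summable (\<lambda>k. (2 powr (- \<delta> * real k * w j)) powr \<alpha> j)"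
    by (simp add: powr_powr powr_realpow[symmetric] mult_ac)
qed

subsection \<open>Extremality\<close>

text \<open>Transference on one ball, indexed by integer pairs: contraction comes from goodness and
  non-planarity, the intersection property from the homogeneous hypothesis.\<close>

proposition locally_not_VWA:
  fixes F :: "'a::euclidean_space \<Rightarrow> real ^ 'n ^ 'm" and r :: "real ^ ('m + 'n)"
  assumes U: "open U" "space M = U" "\<And>T. open T \<Longrightarrow> T \<inter> U \<in> sets M"
    and F: "continuous_on U F"
    and r: "\<And>k. r $ k \<ge> 0" and j0: "r $ Inl j0 > 0"
    and x0: "x0 \<in> msupp M" and \<rho>: "\<rho> > 0" and BU: "ball x0 (3 * \<rho>) \<subseteq> U"
    and fin: "emeasure M (ball x0 (3 * \<rho>)) < \<infinity>"
    and federer: "federer_const_on D (ball x0 (3 * \<rho>)) M"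
    and C: "\<And>j. C j > 0" and \<alpha>: "\<And>j. \<alpha> j > 0"
    and good: "\<And>j (c0::real) c. good_fun_on (C j) (\<alpha> j) (ball x0 (3 * \<rho>)) M (\<lambda>y. c0 + c \<bullet> F y $ j)"
    and nonplanar: "nonplanar_on U (\<lambda>x. F x $ j0) M"
    and homogeneous: "AE x in M. \<not> VWA r (F x) 0"
  shows "AE x in M. x \<in> ball x0 \<rho> \<longrightarrow> \<not> VWA r (F x) z"
proof -
  define B where "B = ball x0 (3 * \<rho>)"
  have balls: "ball x s \<in> sets M" if "ball x s \<subseteq> U" for x s
    using U(3)[of "ball x s"] that by (simp add: Int_absorb2)
  have "ball x0 \<rho> \<subseteq> ball x0 (3 * \<rho>)" using \<rho> by (intro subset_ball) auto
  then have W: "ball x0 \<rho> \<in> sets M" using BU by (intro balls) auto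
  have "AE x in M. x \<in> ball x0 \<rho> \<longrightarrow>
      \<not> (\<exists>\<^sub>\<infinity>k. \<exists>a\<in>admissible r k. dyadic_approx r (1 / real (Suc l)) k (F x) z a)" for l
  proof -
    define e where "e = 1 / real (Suc l)"
    have "e > 0" by (simp add: e_def)
    \<comment> \<open>The exponent \<open>e\<close> belongs to the approximation sets,
      \<open>e / 2\<close> to the enlarged sets and \<open>e / 4\<close> to differences of two
      solutions.\<close>
    then have e: "0 < e / 2" "e / 2 < e" "0 < e / 4" "e / 4 < e / 2" by auto
    define L where "L e k a = {x \<in> U. dyadic_approx r e k (F x) z a}" for e k a
    have L: "L e k a \<in> sets M" for e k a
    proof -
      have "open (U \<inter> F -` {Y. dyadic_approx r e k Y z a})"
        by (rule continuous_open_preimage[OF F U(1) open_dyadic_approx])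
      from U(3)[OF this] show ?thesis
        by (simp add: L_def Int_def vimage_def conj_ac)
    qed
    define \<kappa> where "\<kappa> k = (\<Sum>j | r $ Inl j > 0. C j * (2 powr (- (e - e / 2) * real k * r $ Inl j)) powr \<alpha> j)" for k
    have "\<exists>k0. \<forall>k\<ge>k0. \<forall>a\<in>admissible r k. \<forall>x\<in>L e k a \<inter> msupp M \<inter> ball x0 \<rho>.
       \<exists>s>0. s \<le> 2 * \<rho> \<and> ball x (9 * s) \<subseteq> B \<and> ball x s \<inter> msupp M \<subseteq> L (e / 2) k a \<and>
         emeasure M (L e k a \<inter> ball x (9 * s)) \<le> ennreal (\<kappa> k) * emeasure M (ball x (9 * s))"
      unfolding L_def \<kappa>_def B_def
    by (rule contracting_balls[OF U F j0 x0 \<rho> BU C \<alpha> good nonplanar e(1,2)])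
    then obtain k0 where k0: "\<forall>k\<ge>k0. \<forall>a\<in>admissible r k. \<forall>x\<in>L e k a \<inter> msupp M \<inter> ball x0 \<rho>.
       \<exists>s>0. s \<le> 2 * \<rho> \<and> ball x (9 * s) \<subseteq> B \<and> ball x s \<inter> msupp M \<subseteq> L (e / 2) k a \<and>
         emeasure M (L e k a \<inter> ball x (9 * s)) \<le> ennreal (\<kappa> k) * emeasure M (ball x (9 * s))" by (rule exE)
    obtain c k1 where k1: "\<And>k Y a b. k \<ge> k1 \<Longrightarrow> a \<in> admissible r k \<Longrightarrow> b \<in> admissible r k \<Longrightarrow> a \<noteq> b \<Longrightarrow>
        dyadic_approx r (e / 2) k Y z a \<Longrightarrow> dyadic_approx r (e / 2) k Y z b \<Longrightarrow>
        \<exists>d\<in>admissible r (k + c). dyadic_approx r (e / 4) (k + c) Y 0 d"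
      by (rule dyadic_approx_difference[OF r e(3,4)]) blast
    have "AE x in M. x \<in> ball x0 \<rho> \<longrightarrow> \<not> (\<exists>\<^sub>\<infinity>k. \<exists>a\<in>admissible r k. x \<in> L e k a)"
    proof (rule inhomogeneous_transference[where V=B and k\<^sub>0=k0 and R="2 * \<rho>" and J="L (e / 2)" and \<kappa>=\<kappa>])
      show "federer_const_on D B M"
        using federer by (simp add: B_def)
      show "\<kappa> k \<ge> 0" for k
        unfolding \<kappa>_def using C by (intro sum_nonneg mult_nonneg_nonneg) (auto intro: less_imp_le)
      show "summable \<kappa>"
        unfolding \<kappa>_def using e \<alpha> by (intro summable_powr_decay) auto
      show "AE x in M. x \<in> B \<longrightarrow> \<not> (\<exists>\<^sub>\<infinity>k. \<exists>a\<in>admissible r k. \<exists>b\<in>admissible r k.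
          a \<noteq> b \<and> x \<in> L (e / 2) k a \<inter> L (e / 2) k b)"
        using homogeneous
      proof eventually_elim
        case (elim x)
        show ?case
        proof (intro impI notI)
          assume inf: "\<exists>\<^sub>\<infinity>k. \<exists>a\<in>admissible r k. \<exists>b\<in>admissible r k. a \<noteq> b \<and> x \<in> L (e / 2) k a \<inter> L (e / 2) k b"
          \<comment> \<open>\<open>e / 4 = 1 / (4 * l + 4)\<close> explains the index
            \<open>4 * l + 3\<close>; the constant shift by \<open>c\<close> keeps the levels
            unbounded.\<close>
          have "\<exists>k\<ge>K. \<exists>d\<in>admissible r k. dyadic_approx r (1 / real (Suc (4 * l + 3))) k (F x) 0 d" for K
          proof -
            obtain k a b where "k \<ge> max K k1" "a \<in> admissible r k" "b \<in> admissible r k" "a \<noteq> b"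
              "x \<in> L (e / 2) k a" "x \<in> L (e / 2) k b"
              using inf unfolding INFM_nat_le by blast
            then obtain d where "d \<in> admissible r (k + c)" "dyadic_approx r (e / 4) (k + c) (F x) 0 d"
              using k1[of k a b "F x"] by (auto simp: L_def)
            moreover have "e / 4 = 1 / real (Suc (4 * l + 3))" by (simp add: e_def)
            moreover have "K \<le> k + c" using \<open>k \<ge> max K k1\<close> by simp
            ultimately show ?thesis by metis
          qed
          then have "VWA r (F x) 0"
            unfolding VWA_iff_dyadic[OF r] INFM_nat_le by blast
          with elim show False by simp
        qed
      qed
      show "T \<inter> space M \<in> sets M" if "open T" for T
        using U(3)[OF that] by (simp add: U(2))
      show "B \<subseteq> space M" "B \<in> sets M" "emeasure M B < \<infinity>" "ball x0 \<rho> \<in> sets M"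
        using U(2) BU balls[OF BU] fin W by (auto simp: B_def)
      show "L e k a \<in> sets M" "L (e / 2) k a \<in> sets M" for k a
        by (rule L)+
      show "\<exists>s>0. s \<le> 2 * \<rho> \<and> ball x (9 * s) \<subseteq> B \<and> ball x s \<inter> msupp M \<subseteq> L (e / 2) k a \<and>
         emeasure M (L e k a \<inter> ball x (9 * s)) \<le> ennreal (\<kappa> k) * emeasure M (ball x (9 * s))"
        if "k \<ge> k0" "a \<in> admissible r k" "x \<in> L e k a \<inter> msupp M \<inter> ball x0 \<rho>" for k a x
        using k0 that by blast
    qed
    then show ?thesis
      using AE_space by eventually_elim (simp add: L_def U(2) e_def)
  qed
  then have "AE x in M. \<forall>l. x \<in> ball x0 \<rho> \<longrightarrow>
      \<not> (\<exists>\<^sub>\<infinity>k. \<exists>a\<in>admissible r k. dyadic_approx r (1 / real (Suc l)) k (F x) z a)"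
    by (simp only: AE_all_countable) blast
  then show ?thesis
    unfolding VWA_iff_dyadic[OF r] by eventually_elim blast
qed

lemma good_fun_on_subset:
  assumes "good_fun_on C \<alpha> V M f" "V' \<subseteq> V"
  shows "good_fun_on C \<alpha> V' M f"
  using assms unfolding good_fun_on_def by blast

lemma federer_const_on_subset:
  assumes "federer_const_on D V M" "V' \<subseteq> V"
  shows "federer_const_on D V' M"
  using assms unfolding federer_const_on_def by blast

theorem theorem6p4:
  fixes U :: "(real ^ 'd) set"
    and \<mu> :: "(real ^ 'd) measure"
    and F :: "real ^ 'd \<Rightarrow> real ^ 'n ^ 'm"
    and r :: "real ^ ('m + 'n)"
  assumes "open U"
    and "federer_on U \<mu>"
    and "continuous_on U F"
    and "\<And>k. r $ k \<ge> 0"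
    and "(\<Sum>j\<in>UNIV. r $ Inl j) = 1"
    and "(\<Sum>i\<in>UNIV. r $ Inr i) = 1"
    and "\<And>j. good_pair_on U (\<lambda>x. F x $ j) \<mu>"
    and "\<And>j. nonplanar_on U (\<lambda>x. F x $ j) \<mu>"
  shows "extremal r (distr \<mu> borel F) \<longleftrightarrow> inhomogeneously_extremal r (distr \<mu> borel F)"
proof
  assume "inhomogeneously_extremal r (distr \<mu> borel F)"
  then show "extremal r (distr \<mu> borel F)"
    by (simp add: extremal_def inhomogeneously_extremal_def)
next
  assume ext: "extremal r (distr \<mu> borel F)"
  note U = assms(1) and r = assms(4)
  have sets: "sets \<mu> = sets (restrict_space borel U)"
    and compact: "\<And>K. compact K \<Longrightarrow> K \<subseteq> U \<Longrightarrow> emeasure \<mu> K < \<infinity>"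
    and federer: "AE x in \<mu>. \<exists>V D. open V \<and> x \<in> V \<and> V \<subseteq> U \<and> D > 0 \<and> federer_const_on D V \<mu>"
    using assms(2) unfolding federer_on_def radon_measure_on_def by auto
  have space: "space \<mu> = U"
    using sets_eq_imp_space_eq[OF sets] by (simp add: space_restrict_space)
  have opens: "T \<inter> U \<in> sets \<mu>" if "open T" for T
    unfolding sets sets_restrict_space using that by (intro image_eqI[where x=T]) auto
  have balls: "ball x s \<in> sets \<mu>" if "ball x s \<subseteq> U" for x s
    using opens[of "ball x s"] that by (simp add: Int_absorb2)
  have F: "F \<in> measurable \<mu> borel"
    using borel_measurable_continuous_on_restrict[OF assms(3)]
    by (subst measurable_cong_sets[OF sets refl])
  have homogeneous: "AE x in \<mu>. \<not> VWA r (F x) 0"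
    using ext unfolding extremal_def by (rule AE_distrD[OF F])
  \<comment> \<open>Contraction starts from a row of positive weight, since rows of weight 0 impose
    nothing in \<open>dyadic_approx\<close>.\<close>
  have "\<exists>j. r $ Inl j > 0"
  proof (rule ccontr)
    assume "\<nexists>j. r $ Inl j > 0"
    then have "(\<Sum>j\<in>UNIV. r $ Inl j) \<le> (\<Sum>j\<in>(UNIV :: 'm set). 0)"
      by (intro sum_mono) (simp add: not_less)
    then show False using assms(5) by simp
  qed
  then obtain j0 where j0: "r $ Inl j0 > 0" ..
  have good: "AE x in \<mu>. \<forall>j. \<exists>V C \<alpha>. open V \<and> x \<in> V \<and> V \<subseteq> U \<and> C > 0 \<and> \<alpha> > 0 \<and>
      (\<forall>(c0::real) (c::real ^ 'n). good_fun_on C \<alpha> V \<mu> (\<lambda>y. c0 + c \<bullet> F y $ j))"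
    using assms(7) unfolding good_pair_on_def by (auto simp: AE_all_countable inner_vec_def)
  have "AE x in \<mu>. \<not> VWA r (F x) z" for z
  proof -
    \<comment> \<open>The open sets on which the claim holds almost everywhere; their union inherits
      the claim by Lindelof and contains almost every point.\<close>
    define \<W> where "\<W> = {W. open W \<and> (AE x in \<mu>. x \<in> W \<longrightarrow> \<not> VWA r (F x) z)}"
    have cover: "x0 \<in> \<Union>\<W>" if x0: "x0 \<in> msupp \<mu>"
      and fed: "\<exists>V D. open V \<and> x0 \<in> V \<and> V \<subseteq> U \<and> D > 0 \<and> federer_const_on D V \<mu>"
      and gd: "\<forall>j. \<exists>V C \<alpha>. open V \<and> x0 \<in> V \<and> V \<subseteq> U \<and> C > 0 \<and> \<alpha> > 0 \<and>
        (\<forall>(c0::real) (c::real ^ 'n). good_fun_on C \<alpha> V \<mu> (\<lambda>y. c0 + c \<bullet> F y $ j))"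
      for x0
    proof -
      obtain V0 D where V0: "open V0" "x0 \<in> V0" "V0 \<subseteq> U" "federer_const_on D V0 \<mu>"
        using fed by blast
      obtain V C \<alpha> where V: "\<And>j. open (V j)" "\<And>j. x0 \<in> V j" and C: "\<And>j. C j > 0" and \<alpha>: "\<And>j. \<alpha> j > 0"
        and good': "\<And>j (c0::real) c. good_fun_on (C j) (\<alpha> j) (V j) \<mu> (\<lambda>y. c0 + c \<bullet> F y $ j)"
        using gd by metis
      have "open (V0 \<inter> (\<Inter>j. V j))" using V0 V by (intro open_Int open_INT) auto
      moreover have "x0 \<in> V0 \<inter> (\<Inter>j. V j)" using V0 V by auto
      \<comment> \<open>One closed ball fits into the neighbourhoods of all the finitely many rows.
        Its compactness gives finite measure, and the local result is used with
        \<open>\<rho> = \<sigma> / 3\<close>.\<close>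
      ultimately have "\<exists>\<sigma>>0. cball x0 \<sigma> \<subseteq> V0 \<inter> (\<Inter>j. V j)"
        by (rule open_contains_cball[THEN iffD1, rule_format])
      then obtain \<sigma> where \<sigma>: "\<sigma> > 0" "cball x0 \<sigma> \<subseteq> V0 \<inter> (\<Inter>j. V j)"
        by (elim exE conjE)
      have B: "ball x0 (3 * (\<sigma> / 3)) \<subseteq> cball x0 \<sigma>" by auto
      have cU: "cball x0 \<sigma> \<subseteq> U" using \<sigma> V0 by auto
      have "AE x in \<mu>. x \<in> ball x0 (\<sigma> / 3) \<longrightarrow> \<not> VWA r (F x) z"
      proof (rule locally_not_VWA[OF U space opens assms(3) r j0 x0 _ _ _ _ C \<alpha> _ assms(8) homogeneous])
        show "\<sigma> / 3 > 0" using \<sigma> by simp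
        show "ball x0 (3 * (\<sigma> / 3)) \<subseteq> U" using B cU by (rule order_trans)
        show "emeasure \<mu> (ball x0 (3 * (\<sigma> / 3))) < \<infinity>"
        proof -
          have "cball x0 \<sigma> \<in> sets \<mu>"
            unfolding sets sets_restrict_space using cU by (intro image_eqI[where x="cball x0 \<sigma>"]) auto
          then have "emeasure \<mu> (ball x0 (3 * (\<sigma> / 3))) \<le> emeasure \<mu> (cball x0 \<sigma>)"
            by (rule emeasure_mono[OF B])
          also have "\<dots> < \<infinity>" by (rule compact[OF compact_cball cU])
          finally show ?thesis .
        qed
        have "ball x0 (3 * (\<sigma> / 3)) \<subseteq> V0" using B \<sigma> by blast
        then show "federer_const_on D (ball x0 (3 * (\<sigma> / 3))) \<mu>"
          by (rule federer_const_on_subset[OF V0(4)])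
        have "ball x0 (3 * (\<sigma> / 3)) \<subseteq> V j" for j using B \<sigma> by blast
        then show "good_fun_on (C j) (\<alpha> j) (ball x0 (3 * (\<sigma> / 3))) \<mu> (\<lambda>y. c0 + c \<bullet> F y $ j)"
          for j and c0 :: real and c
          by (rule good_fun_on_subset[OF good'])
      qed
      then have "ball x0 (\<sigma> / 3) \<in> \<W>" by (simp add: \<W>_def)
      moreover have "x0 \<in> ball x0 (\<sigma> / 3)" using \<sigma> by simp
      ultimately show ?thesis by (rule UnionI)
    qed
    have "AE x in \<mu>. x \<in> \<Union>\<W> \<longrightarrow> \<not> VWA r (F x) z"
      by (rule AE_Union_open) (auto simp: \<W>_def)
    moreover have "AE x in \<mu>. x \<in> msupp \<mu>"
      using opens by (intro AE_msupp) (simp add: space)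
    ultimately show ?thesis
      using federer good by eventually_elim (use cover in blast)
  qed
  moreover have "{Y \<in> space borel. \<not> VWA r Y z} \<in> sets borel" for z
  proof -
    have "{Y \<in> space borel. \<not> VWA r Y z} = - {Y. VWA r Y z}" by auto
    then show ?thesis using VWA_measurable[OF r, of z] by (simp add: borel_comp)
  qed
  ultimately show "inhomogeneously_extremal r (distr \<mu> borel F)"
    by (simp add: inhomogeneously_extremal_def AE_distr_iff[OF F])
qed

end
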